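(* Let $\Delta$ be a tree. (i) The following statements are equivalent: (a) $\Delta$ is a linear quotient tree; (b) $\Delta$ is a linear tree. (ii) If $\Delta$ satisfies the equivalent conditions (a), (b), then $\Delta$ is pure and connected in codimension $1$.
   Context: A simplicial complex $\Delta$ on a finite vertex set is a collection of subsets containing all singletons and closed under taking subsets; $\dim F=|F|-1$ for a face $F$. Facets are the maximal faces, $\mathcal F(\Delta)$ is the set of facets; $\Delta$ is pure if all facets have the same dimension. A subcomplex of $\Delta$ is a simplicial complex $\Gamma$ with $\mathcal F(\Gamma)\subseteq\mathcal F(\Delta)$. A chain between facets $F,G$ is a sequence of facets $F=F_0,\dots,F_q=G$ with $F_i\cap F_{i+1}\ne\emptyset$ for all $i$; it is proper if moreover $\dim(F_i\cap F_{i+1})=\dim(F_{i+1})-1$ for all $i$. $\Delta$ is connected if any two facets are joined by a chain, and connected in codimension $1$ if for any two facets $F,G$ with $\dim F\ge\dim G$ there is a proper chain between $F$ and $G$. A facet $F$ is a leaf if it is the only facet of $\Delta$, or there is a facet $G\ne F$ with $F\cap H\subseteq F\cap G$ for every facet $H\ne F$. A tree is a connected simplicial complex every nonempty subcomplex of which has a leaf. $K$ is a field, the vertices of $\Delta$ are identified with the variables of $R=K[x_1,\dots,x_n]$, and the facet ideal of $\Delta$ is generated by the monomials $x_{i_1}\cdots x_{i_s}$ with $\{x_{i_1},\dots,x_{i_s}\}$ a facet. For a monomial ideal $I$, $G(I)$ denotes its minimal set of monomial generators. $I$ is a linear quotient ideal if all elements of $G(I)$ have the same degree and, for some order $f_1,\dots,f_m$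 of the elements of $G(I)$, the colon ideal $(f_1,\dots,f_{i-1}):f_i$ is generated by monomials of degree $1$ for each $i\in\{1,\dots,m\}$ (the zero ideal being allowed). A tree is a linear quotient tree if its facet ideal is a linear quotient ideal, and a linear tree if its facet ideal has a linear resolution. *)

theory Defs
  imports
    "HOL-Library.Poly_Mapping"
    "Jordan_Normal_Form.Matrix_Kernel"
begin

section \<open>Simplicial complexes and trees\<close>

definition simplicial_complex :: "'v set \<Rightarrow> 'v set set \<Rightarrow> bool" where
  "simplicial_complex V \<Delta> \<longleftrightarrow>
     finite V \<and> (\<forall>F\<in>\<Delta>. F \<subseteq> V) \<and> (\<forall>v\<in>V. {v} \<in> \<Delta>) \<and> (\<forall>F\<in>\<Delta>. \<forall>G. G \<subseteq> F \<longrightarrow> G \<in> \<Delta>)"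

text \<open>Integer-valued, since the empty face has dimension \<open>-1\<close>.\<close>

definition face_dim :: "'v set \<Rightarrow> int" where
  "face_dim F = int (card F) - 1"

definition facets :: "'v set set \<Rightarrow> 'v set set" where
  "facets \<Delta> = {F \<in> \<Delta>. \<forall>G\<in>\<Delta>. F \<subseteq> G \<longrightarrow> G = F}"

definition pure_complex :: "'v set set \<Rightarrow> bool" where
  "pure_complex \<Delta> \<longleftrightarrow> (\<forall>F\<in>facets \<Delta>. \<forall>G\<in>facets \<Delta>. face_dim F = face_dim G)"

text \<open>The vertex set of a subcomplex may be smaller than that of \<open>\<Delta>\<close>.\<close>

definition subcomplex :: "'v set set \<Rightarrow> 'v set set \<Rightarrow> bool" where
  "subcomplex \<Gamma> \<Delta> \<longleftrightarrow> (\<exists>W. simplicial_complex W \<Gamma>) \<and> facets \<Gamma> \<subseteq> facets \<Delta>"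

definition facet_chain :: "'v set set \<Rightarrow> 'v set \<Rightarrow> 'v set \<Rightarrow> 'v set list \<Rightarrow> bool" where
  "facet_chain \<Delta> F G Fs \<longleftrightarrow>
     Fs \<noteq> [] \<and> set Fs \<subseteq> facets \<Delta> \<and> hd Fs = F \<and> last Fs = G \<and>
     (\<forall>i. Suc i < length Fs \<longrightarrow> Fs ! i \<inter> Fs ! Suc i \<noteq> {})"

definition proper_facet_chain :: "'v set set \<Rightarrow> 'v set \<Rightarrow> 'v set \<Rightarrow> 'v set list \<Rightarrow> bool" where
  "proper_facet_chain \<Delta> F G Fs \<longleftrightarrow>
     facet_chain \<Delta> F G Fs \<and>
     (\<forall>i. Suc i < length Fs \<longrightarrow> face_dim (Fs ! i \<inter> Fs ! Suc i) = face_dim (Fs ! Suc i) - 1)"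

definition connected_complex :: "'v set set \<Rightarrow> bool" where
  "connected_complex \<Delta> \<longleftrightarrow> (\<forall>F\<in>facets \<Delta>. \<forall>G\<in>facets \<Delta>. \<exists>Fs. facet_chain \<Delta> F G Fs)"

definition connected_in_codim_1 :: "'v set set \<Rightarrow> bool" where
  "connected_in_codim_1 \<Delta> \<longleftrightarrow>
     (\<forall>F\<in>facets \<Delta>. \<forall>G\<in>facets \<Delta>. face_dim F \<ge> face_dim G \<longrightarrow> (\<exists>Fs. proper_facet_chain \<Delta> F G Fs))"

definition is_leaf :: "'v set set \<Rightarrow> 'v set \<Rightarrow> bool" where
  "is_leaf \<Delta> F \<longleftrightarrow>
     F \<in> facets \<Delta> \<and>
     (facets \<Delta> = {F} \<or>
      (\<exists>G\<in>facets \<Delta>. G \<noteq> F \<and> (\<forall>H\<in>facets \<Delta>. H \<noteq> F \<longrightarrow> F \<inter> H \<subseteq> F \<inter> G)))"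

definition tree_complex :: "'v set \<Rightarrow> 'v set set \<Rightarrow> bool" where
  "tree_complex V \<Delta> \<longleftrightarrow>
     simplicial_complex V \<Delta> \<and> connected_complex \<Delta> \<and>
     (\<forall>\<Gamma>. subcomplex \<Gamma> \<Delta> \<and> \<Gamma> \<noteq> {} \<longrightarrow> (\<exists>F. is_leaf \<Gamma> F))"

section \<open>The polynomial ring\<close>

text \<open>
  The polynomial ring \<open>R\<close> over \<open>'k\<close> with one variable for each element of \<open>'v\<close>, realised as the
  monoid ring of the exponent vectors \<open>'v \<Rightarrow>\<^sub>0 nat\<close>. For finite \<open>'v\<close> with \<open>n\<close>
  elements this is \<open>K[x\<^sub>1, \<dots>, x\<^sub>n]\<close>.
\<close>

type_synonym ('v, 'k) mpoly_ring = "('v \<Rightarrow>\<^sub>0 nat) \<Rightarrow>\<^sub>0 'k"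

definition var :: "'v \<Rightarrow> ('v, 'k::field) mpoly_ring" where
  "var v = Poly_Mapping.single (Poly_Mapping.single v 1) 1"

definition is_monomial :: "('v, 'k::field) mpoly_ring \<Rightarrow> bool" where
  "is_monomial f \<longleftrightarrow> (\<exists>m. f = Poly_Mapping.single m 1)"

definition exp_degree :: "('v \<Rightarrow>\<^sub>0 nat) \<Rightarrow> nat" where
  "exp_degree m = (\<Sum>v\<in>Poly_Mapping.keys m. Poly_Mapping.lookup m v)"

text \<open>The zero polynomial is homogeneous of every degree.\<close>

definition homogeneous :: "nat \<Rightarrow> ('v, 'k::field) mpoly_ring \<Rightarrow> bool" where
  "homogeneous d f \<longleftrightarrow> (\<forall>m\<in>Poly_Mapping.keys f. exp_degree m = d)"

abbreviation gen_ideal :: "'r::comm_ring_1 set \<Rightarrow> 'r set" where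
  "gen_ideal S \<equiv> Modules.module.span (*) S"

lemma module_times: "Modules.module ((*) :: 'r::comm_ring_1 \<Rightarrow> 'r \<Rightarrow> 'r)"
  by standard (simp_all add: algebra_simps)

definition colon :: "'r::comm_ring_1 set \<Rightarrow> 'r \<Rightarrow> 'r set" where
  "colon I f = {r. r * f \<in> I}"

definition facet_ideal :: "'v set set \<Rightarrow> ('v, 'k::field) mpoly_ring set" where
  "facet_ideal \<Delta> = gen_ideal ((\<lambda>F. \<Prod>v\<in>F. var v) ` facets \<Delta>)"

section \<open>Linear quotients\<close>

text \<open>
  \<open>minimal_monomial_generators I S\<close> says \<open>S = G(I)\<close>; a monomial ideal has exactly one such \<open>S\<close>.
\<close>

definition minimal_monomial_generators ::
    "('v, 'k::field) mpoly_ring set \<Rightarrow> ('v, 'k) mpoly_ring set \<Rightarrow> bool" where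
  "minimal_monomial_generators I S \<longleftrightarrow>
     (\<forall>f\<in>S. is_monomial f) \<and> gen_ideal S = I \<and> (\<forall>T. T \<subset> S \<longrightarrow> gen_ideal T \<noteq> I)"

text \<open>Taking \<open>S = {}\<close> below covers the case that the colon ideal is zero.\<close>

definition linear_quotient_ideal :: "('v, 'k::field) mpoly_ring set \<Rightarrow> bool" where
  "linear_quotient_ideal I \<longleftrightarrow>
     (\<exists>fs. distinct fs \<and> minimal_monomial_generators I (set fs) \<and>
        (\<exists>d. \<forall>f\<in>set fs. homogeneous d f) \<and>
        (\<forall>i<length fs. \<exists>S. (\<forall>g\<in>S. is_monomial g \<and> homogeneous 1 g) \<and>
            colon (gen_ideal (set (take i fs))) (fs ! i) = gen_ideal S))"

section \<open>Graded free resolutions\<close>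

text \<open>
  A graded free resolution
  \<open>\<dots> \<rightarrow> F\<^sub>1 \<rightarrow> F\<^sub>0 \<rightarrow> I \<rightarrow> 0\<close> of a homogeneous ideal \<open>I\<close> with
  \<open>F\<^sub>i = \<Oplus>\<^bsub>j < b i\<^esub> R(- a i j)\<close>. The matrix \<open>A 0\<close> (a single row) gives the augmentation
  \<open>F\<^sub>0 \<rightarrow> I\<close>, and \<open>A (Suc i)\<close> gives \<open>F\<^sub>i\<^sub>+\<^sub>1 \<rightarrow> F\<^sub>i\<close>. All maps
  preserve degrees: entry \<open>(k, j)\<close> of \<open>A (Suc i)\<close> is zero or homogeneous of degree
  \<open>a (Suc i) j - a i k\<close>. Natural numbers suffice as shifts.
\<close>

definition graded_free_resolution ::
    "('v, 'k::field) mpoly_ring set \<Rightarrow> (nat \<Rightarrow> nat) \<Rightarrow> (nat \<Rightarrow> nat \<Rightarrow> nat) \<Rightarrow>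
     (nat \<Rightarrow> ('v, 'k) mpoly_ring mat) \<Rightarrow> bool" where
  "graded_free_resolution I b a A \<longleftrightarrow>
     A 0 \<in> carrier_mat 1 (b 0) \<and>
     (\<forall>i. A (Suc i) \<in> carrier_mat (b i) (b (Suc i))) \<and>
     (\<forall>j<b 0. homogeneous (a 0 j) (A 0 $$ (0, j))) \<and>
     (\<forall>i. \<forall>k<b i. \<forall>j<b (Suc i). \<forall>m\<in>Poly_Mapping.keys (A (Suc i) $$ (k, j)).
        a i k + exp_degree m = a (Suc i) j) \<and>
     {(A 0 *\<^sub>v x) $ 0 | x. x \<in> carrier_vec (b 0)} = I \<and>
     (\<forall>i. mat_kernel (A i) = {A (Suc i) *\<^sub>v x | x. x \<in> carrier_vec (b (Suc i))})"

text \<open>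
  Minimality: all entries of the maps \<open>F\<^sub>i\<^sub>+\<^sub>1 \<rightarrow> F\<^sub>i\<close> lie in the maximal ideal
  generated by the variables, i.e. have constant term zero.
\<close>

definition minimal_graded_free_resolution ::
    "('v, 'k::field) mpoly_ring set \<Rightarrow> (nat \<Rightarrow> nat) \<Rightarrow> (nat \<Rightarrow> nat \<Rightarrow> nat) \<Rightarrow>
     (nat \<Rightarrow> ('v, 'k) mpoly_ring mat) \<Rightarrow> bool" where
  "minimal_graded_free_resolution I b a A \<longleftrightarrow>
     graded_free_resolution I b a A \<and>
     (\<forall>i. \<forall>k<b i. \<forall>j<b (Suc i). Poly_Mapping.lookup (A (Suc i) $$ (k, j)) 0 = 0)"

text \<open>
  The minimal graded free resolution (unique up to isomorphism) has the form
  \<open>\<dots> \<rightarrow> R(-d-1)\<^bsup>b 1\<^esup> \<rightarrow> R(-d)\<^bsup>b 0\<^esup> \<rightarrow> I \<rightarrow> 0\<close>.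
\<close>

definition has_linear_resolution :: "('v, 'k::field) mpoly_ring set \<Rightarrow> bool" where
  "has_linear_resolution I \<longleftrightarrow>
     (\<exists>b a A d. minimal_graded_free_resolution I b a A \<and> (\<forall>i. \<forall>j<b i. a i j = d + i))"

section \<open>Linear quotient trees and linear trees\<close>

text \<open>
  The vertex set is the whole finite type \<open>'v\<close>, so vertices are identified with the variables of
  \<open>R\<close>. The \<open>itself\<close> argument fixes the coefficient field.
\<close>

definition linear_quotient_tree :: "'k::field itself \<Rightarrow> 'v::finite set set \<Rightarrow> bool" where
  "linear_quotient_tree K \<Delta> \<longleftrightarrow>
     tree_complex UNIV \<Delta> \<and> linear_quotient_ideal (facet_ideal \<Delta> :: ('v, 'k) mpoly_ring set)"

definition linear_tree :: "'k::field itself \<Rightarrow> 'v::finite set set \<Rightarrow> bool" where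
  "linear_tree K \<Delta> \<longleftrightarrow>
     tree_complex UNIV \<Delta> \<and> has_linear_resolution (facet_ideal \<Delta> :: ('v, 'k) mpoly_ring set)"

end

theory Submission
  imports Defs "HOL-Library.Function_Algebras"
begin

text \<open>
  If a list of vectors in a free module has linear quotients, then so does a suitable list of linear
  generators of its syzygy module: each variable in the \<open>i\<close>-th colon ideal contributes one syzygy with
  that variable as its last entry. Iterating builds a linear resolution.

  Conversely, linear first syzygies force any two generators \<open>x\<^bsup>F\<^esup>\<close> and \<open>x\<^bsup>G\<^esup>\<close> to be joined by a
  sequence of facets inside \<open>F \<union> G\<close> in which each step exchanges one vertex: otherwise the monomial
  relation between \<open>F\<close> and \<open>G\<close> would not be a combination of linear ones. This already gives purity
  and connectedness in codimension 1. Since a leaf \<open>F\<close> has a vertex in no other facet, such sequences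
  between other facets avoid \<open>F\<close>, so the property survives removing \<open>F\<close>; listing the leaf last and
  recursing gives an order with linear quotients.
\<close>

interpretation ideal: Modules.module "(*) :: 'r::comm_ring_1 \<Rightarrow> 'r \<Rightarrow> 'r"
  by (rule module_times)

declare ideal.scale_scale [simp del] \<comment> \<open>loops with \<open>mult.assoc\<close>\<close>

section \<open>Monomials and homogeneous components\<close>

lemma keys_empty_iff: "Poly_Mapping.keys f = {} \<longleftrightarrow> f = 0"
proof
  assume "Poly_Mapping.keys f = {}"
  then show "f = 0"
    by (intro poly_mapping_eqI) (metis empty_iff in_keys_iff lookup_zero)
qed simp

lemma exp_degree_superset:
  assumes "finite A" "Poly_Mapping.keys m \<subseteq> A"
  shows "exp_degree m = (\<Sum>v\<in>A. Poly_Mapping.lookup m v)"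
  unfolding exp_degree_def using assms
  by (intro sum.mono_neutral_left) (auto simp: in_keys_iff)

lemma exp_degree_add: "exp_degree (p + q) = exp_degree p + exp_degree q"
proof -
  let ?A = "Poly_Mapping.keys p \<union> Poly_Mapping.keys q"
  have "exp_degree (p + q) = (\<Sum>v\<in>?A. Poly_Mapping.lookup (p + q) v)"
    using Poly_Mapping.keys_add[of p q] by (intro exp_degree_superset) auto
  also have "\<dots> = exp_degree p + exp_degree q"
    by (simp add: lookup_add sum.distrib exp_degree_superset[of ?A])
  finally show ?thesis .
qed

lemma exp_degree_zero [simp]: "exp_degree 0 = 0"
  by (simp add: exp_degree_def)

lemma exp_degree_eq_0_iff: "exp_degree m = 0 \<longleftrightarrow> m = 0"
proof
  assume "exp_degree m = 0"
  then have "Poly_Mapping.keys m = {}"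
    by (simp add: exp_degree_def in_keys_iff del: keys_eq_empty) (simp add: set_eq_iff in_keys_iff)
  then show "m = 0" by (simp add: keys_empty_iff)
qed simp

lemma exp_degree_single [simp]: "exp_degree (Poly_Mapping.single v k) = k"
  by (cases "k = 0") (auto simp: exp_degree_def)

lemma exp_degree_1E:
  assumes "exp_degree m = 1"
  obtains v where "m = Poly_Mapping.single v 1"
proof -
  have "m \<noteq> 0" using assms by auto
  then obtain v where v: "v \<in> Poly_Mapping.keys m"
    by (metis all_not_in_conv keys_empty_iff)
  define q where "q = m - Poly_Mapping.single v 1"
  have m: "m = Poly_Mapping.single v 1 + q"
    using v by (intro poly_mapping_eqI)
      (auto simp: q_def lookup_add lookup_minus lookup_single when_def in_keys_iff)
  then have "exp_degree q = 0"
    using assms by (simp add: exp_degree_add)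
  then show ?thesis using m that by (simp add: exp_degree_eq_0_iff)
qed

lemma keys_add_nat:
  "Poly_Mapping.keys (p + q :: 'a \<Rightarrow>\<^sub>0 nat) = Poly_Mapping.keys p \<union> Poly_Mapping.keys q"
  by (auto simp: in_keys_iff lookup_add)

lemma keys_sumD:
  assumes "m \<in> Poly_Mapping.keys (sum f A)"
  shows "\<exists>x\<in>A. m \<in> Poly_Mapping.keys (f x)"
  using assms by (auto simp: in_keys_iff lookup_sum intro: ccontr)

lemma keys_multD:
  assumes "m \<in> Poly_Mapping.keys (f * g)"
  shows "\<exists>p\<in>Poly_Mapping.keys f. \<exists>q\<in>Poly_Mapping.keys g. m = p + q"
  using assms Poly_Mapping.keys_mult[of f g] by fastforce

lemma poly_mapping_sum_singles:
  "f = (\<Sum>m\<in>Poly_Mapping.keys f. Poly_Mapping.single m (Poly_Mapping.lookup f m))"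
  by (intro poly_mapping_eqI)
    (auto simp: lookup_sum lookup_single when_def in_keys_iff)

text \<open>By cancellation, \<open>m + q = p + q\<close> forces \<open>m = p\<close>, so only the
  term of \<open>f\<close> at \<open>p\<close> reaches the exponent \<open>p + q\<close>.\<close>

lemma lookup_times_single_add [simp]:
  fixes f :: "('a::cancel_comm_monoid_add) \<Rightarrow>\<^sub>0 'b::comm_semiring_0"
  shows "Poly_Mapping.lookup (f * Poly_Mapping.single q c) (p + q) = Poly_Mapping.lookup f p * c"
proof -
  have "f * Poly_Mapping.single q c =
      (\<Sum>m\<in>Poly_Mapping.keys f. Poly_Mapping.single (m + q) (Poly_Mapping.lookup f m * c))"
    using arg_cong[OF poly_mapping_sum_singles[of f], of "\<lambda>f. f * Poly_Mapping.single q c"]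
    by (simp only: sum_distrib_right mult_single)
  then show ?thesis
    by (auto simp: lookup_sum lookup_single when_def in_keys_iff)
qed

lemma lookup_times_single_not_add:
  fixes f :: "('a::cancel_comm_monoid_add) \<Rightarrow>\<^sub>0 'b::comm_semiring_0"
  assumes "\<And>p. m \<noteq> p + q"
  shows "Poly_Mapping.lookup (f * Poly_Mapping.single q c) m = 0"
proof (rule ccontr)
  assume "Poly_Mapping.lookup (f * Poly_Mapping.single q c) m \<noteq> 0"
  then have "m \<in> Poly_Mapping.keys (f * Poly_Mapping.single q c)"
    by (simp add: in_keys_iff)
  from keys_multD[OF this] show False using assms by (auto split: if_splits)
qed

lemma keys_times_monomial:
  fixes f :: "('a::cancel_comm_monoid_add) \<Rightarrow>\<^sub>0 'b::comm_semiring_1"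
  shows "Poly_Mapping.keys (f * Poly_Mapping.single q 1) = (\<lambda>p. p + q) ` Poly_Mapping.keys f"
proof (intro equalityI subsetI)
  fix m assume "m \<in> Poly_Mapping.keys (f * Poly_Mapping.single q 1)"
  from keys_multD[OF this] show "m \<in> (\<lambda>p. p + q) ` Poly_Mapping.keys f"
    by (auto split: if_splits)
qed (auto simp: in_keys_iff)

section \<open>Homogeneous components of polynomials\<close>

lemma homogeneous_zero [simp]: "homogeneous d 0"
  by (simp add: homogeneous_def)

lemma homogeneous_uminus [simp]: "homogeneous d (- f) \<longleftrightarrow> homogeneous d f"
  by (simp add: homogeneous_def in_keys_iff)

lemma homogeneous_var [simp]: "homogeneous 1 (var v)"
  by (simp add: homogeneous_def var_def)

lift_definition hom_comp :: "nat \<Rightarrow> ('v, 'k::field) mpoly_ring \<Rightarrow> ('v, 'k) mpoly_ring"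
  is "\<lambda>d f m. if exp_degree m = d then f m else 0"
proof -
  fix d and f :: "('v \<Rightarrow>\<^sub>0 nat) \<Rightarrow> 'k"
  assume "finite {m. f m \<noteq> 0}"
  then show "finite {m. (if exp_degree m = d then f m else 0) \<noteq> 0}"
    by (rule rev_finite_subset) (auto split: if_splits)
qed

lemma keys_hom_comp: "Poly_Mapping.keys (hom_comp d f) = {m \<in> Poly_Mapping.keys f. exp_degree m = d}"
  by (auto simp: in_keys_iff hom_comp.rep_eq split: if_splits)

lemma homogeneous_hom_comp: "homogeneous d (hom_comp d f)"
  by (simp add: homogeneous_def keys_hom_comp)

lemma hom_comp_add: "hom_comp d (f + g) = hom_comp d f + hom_comp d g"
  by (intro poly_mapping_eqI) (simp add: hom_comp.rep_eq lookup_add)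

lemma hom_comp_0 [simp]: "hom_comp d 0 = 0"
  by (intro poly_mapping_eqI) (simp add: hom_comp.rep_eq)

lemma hom_comp_sum: "hom_comp d (sum f A) = (\<Sum>x\<in>A. hom_comp d (f x))"
  by (induction A rule: infinite_finite_induct) (simp_all add: hom_comp_add)

lemma hom_comp_homogeneous: "homogeneous d f \<Longrightarrow> hom_comp d f = f"
  by (intro poly_mapping_eqI) (auto simp: hom_comp.rep_eq homogeneous_def in_keys_iff)

text \<open>The part of \<open>f\<close> outside degree \<open>d\<close> contributes to
  \<open>f * g\<close> only outside degree \<open>d + e\<close>, because all terms of
  \<open>g\<close> have degree \<open>e\<close>.\<close>

lemma hom_comp_mult:
  assumes "homogeneous e g"
  shows "hom_comp (d + e) (f * g) = hom_comp d f * g"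
proof -
  define r where "r = f - hom_comp d f"
  have f: "f = hom_comp d f + r" by (simp add: r_def)
  have r: "exp_degree m \<noteq> d" if "m \<in> Poly_Mapping.keys r" for m
    using that by (auto simp: r_def in_keys_iff lookup_minus hom_comp.rep_eq)
  have "Poly_Mapping.keys (hom_comp (d + e) (r * g)) = {}"
    using r assms by (auto simp: keys_hom_comp homogeneous_def exp_degree_add dest!: keys_multD)
  moreover have "homogeneous (d + e) (hom_comp d f * g)"
    using assms homogeneous_hom_comp[of d f]
    by (auto simp: homogeneous_def exp_degree_add dest!: keys_multD)
  ultimately show ?thesis
    unfolding keys_empty_iff by (subst f) (simp add: distrib_right hom_comp_add hom_comp_homogeneous)
qed

section \<open>Monomial ideals\<close>

text \<open>Divisibility of every term by some generator survives linear combinations; conversely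
  each such term is itself a multiple of a generator. Ideal membership thereby becomes a condition
  on exponents.\<close>

lemma in_monomial_ideal_iff:
  fixes f :: "('v, 'k::field) mpoly_ring"
  shows "f \<in> gen_ideal ((\<lambda>m. Poly_Mapping.single m 1) ` M) \<longleftrightarrow>
    (\<forall>m\<in>Poly_Mapping.keys f. \<exists>p\<in>M. \<exists>q. m = q + p)"
proof
  assume "f \<in> gen_ideal ((\<lambda>m. Poly_Mapping.single m 1) ` M)"
  then show "\<forall>m\<in>Poly_Mapping.keys f. \<exists>p\<in>M. \<exists>q. m = q + p"
  proof (induction rule: ideal.span_induct_alt)
    case (step c x y)
    from step(1) obtain p where p: "p \<in> M" "x = Poly_Mapping.single p 1" by blast
    show ?case
    proof
      fix m assume "m \<in> Poly_Mapping.keys (c * x + y)"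
      then have "m \<in> Poly_Mapping.keys (c * x) \<or> m \<in> Poly_Mapping.keys y"
        using Poly_Mapping.keys_add[of "c * x" y] by auto
      then show "\<exists>p\<in>M. \<exists>q. m = q + p"
        using step(2) p(1) keys_multD[of m c x] by (auto simp: p(2))
    qed
  qed auto
next
  assume *: "\<forall>m\<in>Poly_Mapping.keys f. \<exists>p\<in>M. \<exists>q. m = q + p"
  have "Poly_Mapping.single m (Poly_Mapping.lookup f m) \<in> gen_ideal ((\<lambda>m. Poly_Mapping.single m 1) ` M)"
    if m: "m \<in> Poly_Mapping.keys f" for m
  proof -
    from * m obtain p q where "p \<in> M" "m = q + p" by auto
    then have "Poly_Mapping.single m (Poly_Mapping.lookup f m) =
      Poly_Mapping.single q (Poly_Mapping.lookup f m) * Poly_Mapping.single p 1"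
      by (simp add: mult_single)
    then show ?thesis using \<open>p \<in> M\<close>
      by (metis (no_types, lifting) ideal.span_base ideal.span_scale imageI)
  qed
  then show "f \<in> gen_ideal ((\<lambda>m. Poly_Mapping.single m 1) ` M)"
    by (subst poly_mapping_sum_singles[of f]) (rule ideal.span_sum)
qed

lemma var_image: "var ` V = (\<lambda>m. Poly_Mapping.single m 1) ` ((\<lambda>v. Poly_Mapping.single v 1) ` V)"
  by (auto simp: var_def image_image)

lemma single_add_iff:
  "(\<exists>q. m = q + Poly_Mapping.single v (1::nat)) \<longleftrightarrow> v \<in> Poly_Mapping.keys m"
proof
  assume v: "v \<in> Poly_Mapping.keys m"
  have "m = (m - Poly_Mapping.single v 1) + Poly_Mapping.single v 1"
    using v by (intro poly_mapping_eqI)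
      (auto simp: lookup_add lookup_minus lookup_single when_def in_keys_iff)
  then show "\<exists>q. m = q + Poly_Mapping.single v 1" by blast
qed (auto simp: keys_add_nat)

lemma in_var_ideal_iff:
  fixes f :: "('v, 'k::field) mpoly_ring"
  shows "f \<in> gen_ideal (var ` V) \<longleftrightarrow> (\<forall>m\<in>Poly_Mapping.keys f. Poly_Mapping.keys m \<inter> V \<noteq> {})"
  unfolding var_image in_monomial_ideal_iff bex_simps single_add_iff by auto

text \<open>A variable outside \<open>V\<close> does not change whether the support of a term meets
  \<open>V\<close>. This computes the colon ideals of the new syzygies in
  \<open>syz_lin_quot\<close>.\<close>

lemma times_var_in_var_ideal_iff:
  assumes "v \<notin> V"
  shows "r * var v \<in> gen_ideal (var ` V) \<longleftrightarrow> r \<in> gen_ideal (var ` V)"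
proof -
  have "Poly_Mapping.keys (m + Poly_Mapping.single v (1::nat)) \<inter> V = Poly_Mapping.keys m \<inter> V" for m
    using assms by (simp add: keys_add_nat)
  then show ?thesis
    unfolding in_var_ideal_iff by (simp add: var_def keys_times_monomial)
qed

section \<open>Linear quotients give linear resolutions\<close>

definition fscale :: "'r::comm_ring_1 \<Rightarrow> ('i \<Rightarrow> 'r) \<Rightarrow> 'i \<Rightarrow> 'r" where
  "fscale r f = (\<lambda>i. r * f i)"

lemma module_fscale: "Modules.module (fscale :: 'r::comm_ring_1 \<Rightarrow> ('i \<Rightarrow> 'r) \<Rightarrow> 'i \<Rightarrow> 'r)"
  by (rule Modules.module.intro; rule ext) (simp_all add: fscale_def distrib_left distrib_right mult.assoc)

interpretation free_module: Modules.module "fscale :: 'r::comm_ring_1 \<Rightarrow> ('i \<Rightarrow> 'r) \<Rightarrow> 'i \<Rightarrow> 'r"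
  by (rule module_fscale)

definition lincomb :: "(nat \<Rightarrow> 'r::comm_ring_1) list \<Rightarrow> (nat \<Rightarrow> 'r) \<Rightarrow> nat \<Rightarrow> 'r" where
  "lincomb cs y = (\<lambda>i. \<Sum>j<length cs. y j * (cs ! j) i)"

text \<open>
  A vector of the free module of rank \<open>n\<close> is a function on \<open>nat\<close> that vanishes from \<open>n\<close> on.
\<close>

definition syz :: "(nat \<Rightarrow> 'r::comm_ring_1) list \<Rightarrow> (nat \<Rightarrow> 'r) set" where
  "syz cs = {y. (\<forall>j\<ge>length cs. y j = 0) \<and> lincomb cs y = 0}"

text \<open>Linear quotients for lists of vectors instead of ring elements, so that the notion
  applies again to the syzygies of the list. An empty \<open>V\<close> encodes a zero colon
  ideal.\<close>

inductive lin_quot :: "nat \<Rightarrow> (nat \<Rightarrow> ('v, 'k::field) mpoly_ring) list \<Rightarrow> bool" for e where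
  Nil: "lin_quot e []"
| snoc: "lin_quot e cs \<Longrightarrow> (\<And>k. homogeneous e (c k)) \<Longrightarrow>
    {r. fscale r c \<in> free_module.span (set cs)} = gen_ideal (var ` V) \<Longrightarrow> lin_quot e (cs @ [c])"

lemma lin_quot_homogeneous: "lin_quot e cs \<Longrightarrow> c \<in> set cs \<Longrightarrow> homogeneous e (c k)"
  by (induction rule: lin_quot.induct) auto

lemma lincomb_snoc: "lincomb (cs @ [c]) y = lincomb cs y + fscale (y (length cs)) c"
  by (rule ext) (auto simp: lincomb_def fscale_def nth_append intro!: sum.cong)

lemma lincomb_cong: "(\<And>j. j < length cs \<Longrightarrow> y j = z j) \<Longrightarrow> lincomb cs y = lincomb cs z"
  by (auto simp: lincomb_def)

lemma lincomb_add: "lincomb cs (y + z) = lincomb cs y + lincomb cs z"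
  by (rule ext) (simp add: lincomb_def distrib_right sum.distrib)

lemma lincomb_uminus: "lincomb cs (- y) = - lincomb cs y"
  by (rule ext) (simp add: lincomb_def sum_negf)

lemma lincomb_fscale: "lincomb cs (fscale r y) = fscale r (lincomb cs y)"
  by (rule ext) (simp add: lincomb_def fscale_def sum_distrib_left mult.assoc)

text \<open>A vector lies in the span of \<open>cs @ [c]\<close> iff subtracting some multiple of
  \<open>c\<close> brings it into the span of \<open>cs\<close>. That multiple is stored at position
  \<open>length cs\<close>, which \<open>lincomb cs\<close> does not read.\<close>

lemma span_set_eq_range_lincomb: "free_module.span (set cs) = range (lincomb cs)"
proof (induction cs rule: rev_induct)
  case Nil
  then show ?case by (auto simp: lincomb_def zero_fun_def)
next
  case (snoc c cs)
  have "x \<in> free_module.span (set (cs @ [c])) \<longleftrightarrow> x \<in> range (lincomb (cs @ [c]))" for x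
  proof -
    have "x \<in> free_module.span (set (cs @ [c])) \<longleftrightarrow> (\<exists>k. x - fscale k c \<in> range (lincomb cs))"
      by (simp add: free_module.span_breakdown_eq snoc)
    also have "\<dots> \<longleftrightarrow> x \<in> range (lincomb (cs @ [c]))"
    proof
      assume "\<exists>k. x - fscale k c \<in> range (lincomb cs)"
      then obtain k y where "x - fscale k c = lincomb cs y" by blast
      then have "x = lincomb (cs @ [c]) (y(length cs := k))"
        using lincomb_cong[of cs y "y(length cs := k)"]
        by (simp add: lincomb_snoc algebra_simps)
      then show "x \<in> range (lincomb (cs @ [c]))" by blast
    next
      assume "x \<in> range (lincomb (cs @ [c]))"
      then obtain y where "x = lincomb cs y + fscale (y (length cs)) c"
        by (auto simp: lincomb_snoc)
      then have "x - fscale (y (length cs)) c = lincomb cs y" by simp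
      then show "\<exists>k. x - fscale k c \<in> range (lincomb cs)" by blast
    qed
    finally show ?thesis .
  qed
  then show ?case by blast
qed

lemma syz_add: "y \<in> syz cs \<Longrightarrow> z \<in> syz cs \<Longrightarrow> y + z \<in> syz cs"
  by (simp add: syz_def lincomb_add)

lemma syz_fscale: "y \<in> syz cs \<Longrightarrow> fscale r y \<in> syz cs"
  by (simp add: syz_def lincomb_fscale) (simp add: fscale_def)

lemma syz_diff: "y \<in> syz cs \<Longrightarrow> z \<in> syz cs \<Longrightarrow> y - z \<in> syz cs"
  using syz_add[of y cs "fscale (- 1) z"] syz_fscale[of z cs "- 1"] by simp

text \<open>Both sides of a relation for \<open>var v\<close> times \<open>c\<close> live in degree
  \<open>1 + e\<close>, so replacing its coefficients by their degree 1 components preserves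
  it.\<close>

lemma linear_relation:
  assumes "\<And>x k. x \<in> set cs \<Longrightarrow> homogeneous e (x k)" "\<And>k. homogeneous e (c k)"
    and "fscale (var v) c \<in> free_module.span (set cs)"
  obtains a where "\<And>j. homogeneous 1 (a j)" "\<And>j. length cs \<le> j \<Longrightarrow> a j = 0"
    "lincomb cs a = fscale (var v) c"
proof -
  obtain y where y: "fscale (var v) c = lincomb cs y"
    using assms(3) unfolding span_set_eq_range_lincomb by blast
  define a where "a j = (if j < length cs then hom_comp 1 (y j) else 0)" for j
  have "lincomb cs a i = fscale (var v) c i" for i
  proof -
    have "lincomb cs a i = hom_comp (1 + e) (lincomb cs y i)"
      using assms(1) by (simp add: lincomb_def a_def hom_comp_sum hom_comp_mult del: plus_1_eq_Suc One_nat_def)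
    also have "\<dots> = hom_comp (1 + e) (var v * c i)"
      using fun_cong[OF y, of i] by (simp add: fscale_def)
    also have "\<dots> = var v * c i"
      using assms(2)[of i] homogeneous_var[of v]
      by (simp add: hom_comp_mult hom_comp_homogeneous del: plus_1_eq_Suc One_nat_def)
    finally show ?thesis by (simp add: fscale_def)
  qed
  then show ?thesis
    by (intro that[of a]) (auto simp: a_def homogeneous_hom_comp)
qed

text \<open>The inductive step of the resolution. Each variable \<open>v\<close> of the last colon
  ideal yields a linear syzygy ending in \<open>var v\<close>; its colon ideal against the
  generators already listed is generated by the variables treated before \<open>v\<close>. The new
  degree is 1 whatever \<open>e\<close> is.\<close>

lemma syz_lin_quot:
  fixes cs :: "(nat \<Rightarrow> ('v::finite, 'k::field) mpoly_ring) list"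
  assumes "lin_quot e cs"
  shows "\<exists>ds. lin_quot 1 ds \<and> free_module.span (set ds) = syz cs"
  using assms
proof (induction rule: lin_quot.induct)
  case Nil
  have "free_module.span (set []) = syz ([] :: (nat \<Rightarrow> ('v, 'k) mpoly_ring) list)"
    by (auto simp: syz_def lincomb_def zero_fun_def)
  then show ?case using lin_quot.Nil by blast
next
  case (snoc cs c V)
  let ?n = "length cs"
  \<comment> \<open>The syzygies whose last entry lies in the ideal of the variables \<open>W\<close>; enlarging \<open>W\<close>
    by one variable adds one generator.\<close>
  define Z where "Z W = {y \<in> syz (cs @ [c]). y ?n \<in> gen_ideal (var ` W)}" for W :: "'v set"
  have "\<exists>ds. lin_quot 1 ds \<and> free_module.span (set ds) = Z W" if "finite W" "W \<subseteq> V" for W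
    using that
  proof (induction W rule: finite_induct)
    case empty
    \<comment> \<open>Without variables the ideal is zero, so the last entry vanishes and only a
      syzygy of \<open>cs\<close> remains.\<close>
    have "Z {} = syz cs"
      by (auto simp: Z_def syz_def lincomb_snoc) (metis Suc_leI le_neq_implies_less)
    then show ?case using snoc.IH by auto
  next
    case (insert v W)
    then obtain ds where ds: "lin_quot 1 ds" "free_module.span (set ds) = Z W" by auto
    have "fscale (var v) c \<in> free_module.span (set cs)"
      using snoc.hyps(3) insert.prems ideal.span_base[of "var v" "var ` V"] by auto
    then obtain a where a: "\<And>j. homogeneous 1 (a j)" "\<And>j. ?n \<le> j \<Longrightarrow> a j = 0"
      "lincomb cs a = fscale (var v) c"
      using linear_relation[of cs e c v] lin_quot_homogeneous[OF snoc.hyps(1)] snoc.hyps(2) by blast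
    \<comment> \<open>\<open>a\<close> expresses \<open>var v\<close> times \<open>c\<close> through
      \<open>cs\<close>; moving it to the other side gives a syzygy with last entry
      \<open>var v\<close>.\<close>
    define s where "s = (- a)(?n := var v)"
    have s_hom: "homogeneous 1 (s j)" for j
      using a(1)[of j] homogeneous_var[of v] by (auto simp: s_def)
    have "lincomb cs s = - lincomb cs a"
      using lincomb_cong[of cs s "- a"] by (simp add: s_def lincomb_uminus)
    then have s: "s \<in> syz (cs @ [c])"
      using a(2,3) by (auto simp: syz_def lincomb_snoc s_def)
    have sn: "s ?n = var v" by (simp add: s_def)
    have "fscale r s ?n = r * var v" for r by (simp add: fscale_def sn)
    \<comment> \<open>Multiples of \<open>s\<close> are always syzygies, so membership in
      \<open>Z W\<close> is decided by the last entry \<open>r * var v\<close>, where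
      \<open>v\<close> is not in \<open>W\<close>.\<close>
    then have colon: "{r. fscale r s \<in> free_module.span (set ds)} = gen_ideal (var ` W)"
      by (simp add: ds(2) Z_def syz_fscale[OF s] times_var_in_var_ideal_iff[OF insert.hyps(2)])
    have "y \<in> free_module.span (set (ds @ [s])) \<longleftrightarrow> y \<in> Z (insert v W)" for y
    proof -
      have "y \<in> free_module.span (set (ds @ [s])) \<longleftrightarrow> (\<exists>k. y - fscale k s \<in> Z W)"
        by (simp add: free_module.span_breakdown_eq ds(2))
      also have "\<dots> \<longleftrightarrow> (\<exists>k. y \<in> syz (cs @ [c]) \<and> y ?n - k * var v \<in> gen_ideal (var ` W))"
      proof -
        have "y - fscale k s \<in> syz (cs @ [c]) \<longleftrightarrow> y \<in> syz (cs @ [c])" for k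
          using syz_diff[of y "cs @ [c]" "fscale k s"] syz_add[of "y - fscale k s" "cs @ [c]" "fscale k s"]
            syz_fscale[OF s, of k] by auto
        moreover have "(y - fscale k s) ?n = y ?n - k * var v" for k
          by (simp add: fscale_def sn)
        ultimately show ?thesis by (simp add: Z_def)
      qed
      also have "\<dots> \<longleftrightarrow> y \<in> Z (insert v W)"
        by (simp add: Z_def ideal.span_breakdown_eq)
      finally show ?thesis .
    qed
    then have "free_module.span (set (ds @ [s])) = Z (insert v W)" by blast
    then show ?case using lin_quot.snoc[OF ds(1) s_hom colon] by blast
  qed
  then obtain ds where ds: "lin_quot 1 ds" "free_module.span (set ds) = Z V"
    by (meson finite order_refl)
  have "Z V = syz (cs @ [c])"
  proof -
    \<comment> \<open>A syzygy writes its last coefficient times \<open>c\<close> as a combination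
      of \<open>cs\<close>, so that coefficient lies in the colon ideal.\<close>
    have "y ?n \<in> gen_ideal (var ` V)" if "y \<in> syz (cs @ [c])" for y
    proof -
      have "fscale (y ?n) c = lincomb cs (- y)"
        using that by (simp add: syz_def lincomb_snoc lincomb_uminus add_eq_0_iff)
      then have "fscale (y ?n) c \<in> free_module.span (set cs)"
        by (simp add: span_set_eq_range_lincomb)
      then show ?thesis using snoc.hyps(3) by auto
    qed
    then show ?thesis by (auto simp: Z_def)
  qed
  then show ?case using ds by auto
qed

section \<open>Lists of vectors as matrices\<close>

definition col_mat :: "nat \<Rightarrow> (nat \<Rightarrow> 'r) list \<Rightarrow> 'r mat" where
  "col_mat n cs = mat n (length cs) (\<lambda>(k, j). (cs ! j) k)"

lemma col_mat_carrier [simp]: "col_mat n cs \<in> carrier_mat n (length cs)"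
  by (simp add: col_mat_def)

lemma col_mat_mult_vec:
  assumes "x \<in> carrier_vec (length cs)"
  shows "col_mat n cs *\<^sub>v x = vec n (lincomb cs (\<lambda>j. x $ j))"
  using assms
  by (intro eq_vecI) (auto simp: col_mat_def lincomb_def scalar_prod_def atLeast0LessThan mult.commute intro!: sum.cong)

text \<open>Carries exactness from functions on \<open>nat\<close> to matrices: by
  \<open>supp\<close>, no entry of a linear combination is lost when only the first \<open>n\<close>
  rows are kept.\<close>

lemma mat_kernel_col_mat:
  assumes supp: "\<And>c k. c \<in> set cs \<Longrightarrow> n \<le> k \<Longrightarrow> c k = 0"
    and span: "free_module.span (set ds) = syz cs"
  shows "mat_kernel (col_mat n cs) = {col_mat (length cs) ds *\<^sub>v x | x. x \<in> carrier_vec (length ds)}"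
proof (intro equalityI subsetI)
  fix x assume "x \<in> mat_kernel (col_mat n cs)"
  then have x: "x \<in> carrier_vec (length cs)" "col_mat n cs *\<^sub>v x = 0\<^sub>v n"
    by (auto simp: mat_kernel_def col_mat_def)
  \<comment> \<open>Membership in \<open>syz\<close> demands zeros from \<open>length cs\<close> on,
    whereas the entries of \<open>x\<close> beyond its dimension are unspecified.\<close>
  define y where "y j = (if j < length cs then x $ j else 0)" for j
  have lc: "lincomb cs y = lincomb cs (\<lambda>j. x $ j)"
    by (rule lincomb_cong) (simp add: y_def)
  have "lincomb cs y k = 0" for k
  proof (cases "k < n")
    case True
    then show ?thesis using arg_cong[OF x(2), of "\<lambda>v. v $ k"]
      by (simp add: col_mat_mult_vec[OF x(1)] lc)
  next
    case False
    then show ?thesis using supp[OF nth_mem] by (auto simp: lincomb_def intro!: sum.neutral)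
  qed
  then have "y \<in> syz cs" by (auto simp: syz_def y_def)
  then obtain z where z: "y = lincomb ds z"
    unfolding span[symmetric] span_set_eq_range_lincomb by blast
  have "x = col_mat (length cs) ds *\<^sub>v vec (length ds) z"
  proof (intro eq_vecI)
    fix i assume "i < dim_vec (col_mat (length cs) ds *\<^sub>v vec (length ds) z)"
    then have i: "i < length cs" by (simp add: col_mat_def)
    have "x $ i = lincomb ds z i" using i by (simp flip: z add: y_def)
    also have "\<dots> = lincomb ds (\<lambda>j. vec (length ds) z $ j) i"
      by (simp add: lincomb_def)
    finally show "x $ i = (col_mat (length cs) ds *\<^sub>v vec (length ds) z) $ i"
      using i by (simp add: col_mat_mult_vec)
  qed (use x(1) in \<open>simp add: col_mat_def\<close>)
  then show "x \<in> {col_mat (length cs) ds *\<^sub>v x | x. x \<in> carrier_vec (length ds)}"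
    by auto
next
  fix x assume "x \<in> {col_mat (length cs) ds *\<^sub>v x | x. x \<in> carrier_vec (length ds)}"
  then obtain z where z: "z \<in> carrier_vec (length ds)" "x = col_mat (length cs) ds *\<^sub>v z" by blast
  let ?y = "lincomb ds (\<lambda>j. z $ j)"
  have "?y \<in> syz cs"
    unfolding span[symmetric] span_set_eq_range_lincomb by blast
  moreover have x: "x = vec (length cs) ?y" using z by (simp add: col_mat_mult_vec)
  moreover have "lincomb cs (\<lambda>j. x $ j) = lincomb cs ?y"
    by (rule lincomb_cong) (simp add: x)
  ultimately have "x \<in> carrier_vec (length cs)" "col_mat n cs *\<^sub>v x = 0\<^sub>v n"
    by (auto simp: col_mat_mult_vec syz_def)
  then show "x \<in> mat_kernel (col_mat n cs)"
    by (simp add: mat_kernel_def col_mat_def)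
qed

section \<open>Ideals as submodules of the free module of rank one\<close>

definition emb :: "'r::zero \<Rightarrow> nat \<Rightarrow> 'r" where
  "emb f = (\<lambda>k. if k = 0 then f else 0)"

lemma emb_0 [simp]: "emb f 0 = f"
  by (simp add: emb_def)

lemma fscale_emb: "fscale r (emb f) = emb (r * f)"
  by (rule ext) (simp add: fscale_def emb_def)

lemma emb_add: "emb (f + g :: 'r::comm_ring_1) = emb f + emb g"
  by (rule ext) (simp add: emb_def)

lemma emb_zero: "emb 0 = (0 :: nat \<Rightarrow> 'r::comm_ring_1)"
  by (rule ext) (simp add: emb_def)

text \<open>\<open>emb\<close> is additive and turns multiplication into \<open>fscale\<close>, so
  it carries generated ideals to generated submodules.\<close>

lemma span_emb: "free_module.span (emb ` S) = emb ` gen_ideal S"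
proof
  have "free_module.subspace (emb ` gen_ideal S)"
  proof (rule free_module.subspaceI)
    show "0 \<in> emb ` gen_ideal S"
      using ideal.span_zero[of S] emb_zero by (metis image_eqI)
  qed (auto simp: fscale_emb ideal.span_add ideal.span_scale simp flip: emb_add)
  then show "free_module.span (emb ` S) \<subseteq> emb ` gen_ideal S"
    by (intro free_module.span_minimal image_mono ideal.span_superset)
  show "emb ` gen_ideal S \<subseteq> free_module.span (emb ` S)"
  proof (rule image_subsetI)
    fix f assume "f \<in> gen_ideal S"
    then show "emb f \<in> free_module.span (emb ` S)"
    proof (induction rule: ideal.span_induct_alt)
      case base
      show ?case unfolding emb_zero by (rule free_module.span_zero)
    next
      case (step c x y)
      have "fscale c (emb x) \<in> free_module.span (emb ` S)"
        using step(1) by (intro free_module.span_scale free_module.span_base imageI)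
      then have "fscale c (emb x) + emb y \<in> free_module.span (emb ` S)"
        using step(2) by (rule free_module.span_add)
      then show ?case unfolding fscale_emb emb_add .
    qed
  qed
qed

lemma emb_in_span_iff: "emb f \<in> free_module.span (emb ` S) \<longleftrightarrow> f \<in> gen_ideal S"
  unfolding span_emb by (metis (no_types, lifting) emb_0 image_iff)

text \<open>An exponent of degree 1 is a single variable. This brings the colon ideals of a linear
  quotient ideal into the form that \<open>lin_quot\<close> requires.\<close>

lemma linear_monomials:
  fixes S :: "('v, 'k::field) mpoly_ring set"
  assumes "\<forall>g\<in>S. is_monomial g \<and> homogeneous 1 g"
  shows "S = var ` {v. var v \<in> S}"
proof -
  have "g \<in> var ` {v. var v \<in> S}" if "g \<in> S" for g
  proof -
    from assms that obtain m where m: "g = Poly_Mapping.single m 1" and "homogeneous 1 g"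
      by (auto simp: is_monomial_def)
    then have "exp_degree m = 1" by (simp add: homogeneous_def)
    then obtain v where "m = Poly_Mapping.single v 1" by (rule exp_degree_1E)
    then have "g = var v" using m by (simp add: var_def)
    then show ?thesis using that by blast
  qed
  then show ?thesis by blast
qed

lemma lin_quot_map_emb:
  fixes fs :: "('v, 'k::field) mpoly_ring list"
  assumes "\<forall>f\<in>set fs. homogeneous d f"
    and "\<forall>i<length fs. \<exists>V. colon (gen_ideal (set (take i fs))) (fs ! i) = gen_ideal (var ` V)"
  shows "lin_quot d (map emb fs)"
  using assms
proof (induction fs rule: rev_induct)
  case Nil
  show ?case by (simp add: lin_quot.Nil)
next
  case (snoc f fs)
  have "\<exists>V. colon (gen_ideal (set (take i fs))) (fs ! i) = gen_ideal (var ` V)" if "i < length fs" for i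
    using snoc.prems(2)[rule_format, of i] that by (simp add: nth_append)
  then have "lin_quot d (map emb fs)"
    using snoc.IH snoc.prems(1) by simp
  moreover have "homogeneous d (emb f k)" for k
    using snoc.prems(1) by (simp add: emb_def)
  moreover obtain V where "colon (gen_ideal (set fs)) f = gen_ideal (var ` V)"
    using snoc.prems(2)[rule_format, of "length fs"] by auto
  then have "{r. fscale r (emb f) \<in> free_module.span (set (map emb fs))} = gen_ideal (var ` V)"
    by (simp add: fscale_emb emb_in_span_iff colon_def)
  ultimately show ?case
    by (simp add: lin_quot.snoc)
qed

text \<open>The generators are placed in rank one and \<open>syz_lin_quot\<close> is iterated. All
  maps after the augmentation have linear entries, which gives both the shifts \<open>d + i\<close>
  and minimality.\<close>

theorem linear_quotient_ideal_imp_linear_resolution: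
  fixes I :: "('v::finite, 'k::field) mpoly_ring set"
  assumes "linear_quotient_ideal I"
  shows "has_linear_resolution I"
proof -
  obtain fs d where I: "gen_ideal (set fs) = I" and hom: "\<forall>f\<in>set fs. homogeneous d f"
    and colon: "\<forall>i<length fs. \<exists>S. (\<forall>g\<in>S. is_monomial g \<and> homogeneous 1 g) \<and>
            colon (gen_ideal (set (take i fs))) (fs ! i) = gen_ideal S"
    using assms unfolding linear_quotient_ideal_def minimal_monomial_generators_def by metis
  have "\<exists>V. colon (gen_ideal (set (take i fs))) (fs ! i) = gen_ideal (var ` V)" if "i < length fs" for i
    using colon[rule_format, OF that] linear_monomials by metis
  then have start: "lin_quot d (map emb fs)" using hom by (intro lin_quot_map_emb) auto
  define P where "P n cs \<longleftrightarrow> lin_quot (if n = 0 then d else 1) cs \<and> (n = 0 \<longrightarrow> cs = map emb fs)"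
    for n :: nat and cs :: "(nat \<Rightarrow> ('v, 'k) mpoly_ring) list"
  \<comment> \<open>\<open>D n\<close> lists the columns of the \<open>n\<close>-th map: entries of
    degree \<open>d\<close> at stage 0, linear forms at every later stage.\<close>
  have "\<exists>D. \<forall>n. P n (D n) \<and> free_module.span (set (D (Suc n))) = syz (D n)"
  proof (rule dependent_nat_choice)
    show "\<exists>cs. P 0 cs" using start by (auto simp: P_def)
    show "\<exists>ds. P (Suc n) ds \<and> free_module.span (set ds) = syz cs" if "P n cs" for cs n
      using that syz_lin_quot[of _ cs] by (auto simp: P_def)
  qed
  then obtain D where D: "\<And>n. P n (D n)" "\<And>n. free_module.span (set (D (Suc n))) = syz (D n)"
    by blast
  define b where "b i = length (D i)" for i
  \<comment> \<open>The augmentation has one row; every later map has as many rows as its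
    predecessor has columns.\<close>
  define rows where "rows i = (case i of 0 \<Rightarrow> 1 | Suc j \<Rightarrow> b j)" for i
  define A where "A i = col_mat (rows i) (D i)" for i
  have D0: "D 0 = map emb fs" using D(1)[of 0] by (simp add: P_def)
  have hom0: "homogeneous d (c k)" if "c \<in> set (D 0)" for c k
    using D(1)[of 0] that by (auto simp: P_def intro: lin_quot_homogeneous)
  have homS: "homogeneous 1 (c k)" if "c \<in> set (D (Suc i))" for c k i
    using D(1)[of "Suc i"] that by (auto simp: P_def intro: lin_quot_homogeneous)
  have supp: "c k = 0" if "c \<in> set (D i)" "rows i \<le> k" for c i k
  proof (cases i)
    case 0
    then show ?thesis using that by (auto simp: D0 rows_def emb_def)
  next
    case (Suc j)
    then have "c \<in> syz (D j)"
      using that(1) D(2)[of j] free_module.span_base by blast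
    then show ?thesis using that(2) Suc by (simp add: rows_def b_def syz_def)
  qed
  have A0: "A 0 $$ (0, j) = (D 0 ! j) 0" if "j < b 0" for j
    using that by (simp add: A_def col_mat_def rows_def b_def)
  have AS: "A (Suc i) $$ (k, j) = (D (Suc i) ! j) k" if "k < b i" "j < b (Suc i)" for i j k
    using that by (simp add: A_def col_mat_def rows_def b_def)
  have AShom: "homogeneous 1 (A (Suc i) $$ (k, j))" if "k < b i" "j < b (Suc i)" for i j k
    using that homS[OF nth_mem] by (simp add: AS b_def)
  have image: "{(A 0 *\<^sub>v x) $ 0 | x. x \<in> carrier_vec (b 0)} = I"
  proof -
    have "f \<in> I \<longleftrightarrow> (\<exists>x\<in>carrier_vec (b 0). f = (A 0 *\<^sub>v x) $ 0)" for f
    proof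
      assume "f \<in> I"
      then have "emb f \<in> free_module.span (set (D 0))"
        by (simp add: D0 emb_in_span_iff I)
      then obtain y where y: "emb f = lincomb (D 0) y"
        by (auto simp: span_set_eq_range_lincomb)
      have "(A 0 *\<^sub>v vec (b 0) y) $ 0 = lincomb (D 0) (\<lambda>j. vec (b 0) y $ j) 0"
        by (simp add: A_def b_def col_mat_mult_vec rows_def)
      also have "\<dots> = lincomb (D 0) y 0"
        by (simp add: b_def lincomb_def)
      finally show "\<exists>x\<in>carrier_vec (b 0). f = (A 0 *\<^sub>v x) $ 0"
        using fun_cong[OF y, of 0] by (intro bexI[of _ "vec (b 0) y"]) auto
    next
      assume "\<exists>x\<in>carrier_vec (b 0). f = (A 0 *\<^sub>v x) $ 0"
      then obtain x where "x \<in> carrier_vec (b 0)" "f = (A 0 *\<^sub>v x) $ 0" by blast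
      then have f: "f = lincomb (D 0) (\<lambda>j. x $ j) 0"
        by (simp add: A_def b_def col_mat_mult_vec rows_def)
      \<comment> \<open>The vectors of \<open>D 0\<close> vanish outside coordinate 0, so the value
        there determines the whole combination.\<close>
      have "lincomb (D 0) (\<lambda>j. x $ j) = emb f"
      proof
        fix k show "lincomb (D 0) (\<lambda>j. x $ j) k = emb f k"
        proof (cases "k = 0")
          case False
          have "(D 0 ! j) k = 0" if "j < length (D 0)" for j
            using that False supp[of "D 0 ! j" 0 k] by (simp add: rows_def)
          then show ?thesis using False by (simp add: emb_def lincomb_def)
        qed (simp add: f)
      qed
      then have "emb f \<in> free_module.span (set (D 0))"
        unfolding span_set_eq_range_lincomb by (metis rangeI)
      then show "f \<in> I" by (simp add: D0 emb_in_span_iff I)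
    qed
    then show ?thesis by blast
  qed
  have "graded_free_resolution I b (\<lambda>i j. d + i) A"
    unfolding graded_free_resolution_def
  proof (intro conjI allI impI ballI)
    show "A 0 \<in> carrier_mat 1 (b 0)" "A (Suc i) \<in> carrier_mat (b i) (b (Suc i))" for i
      by (simp_all add: A_def b_def rows_def)
    show "homogeneous (d + 0) (A 0 $$ (0, j))" if "j < b 0" for j
      using that hom0[OF nth_mem] by (simp add: A0 b_def)
    show "d + i + exp_degree m = d + Suc i"
      if "k < b i" "j < b (Suc i)" "m \<in> Poly_Mapping.keys (A (Suc i) $$ (k, j))" for i k j m
      using AShom[OF that(1,2)] that(3) by (simp add: homogeneous_def)
    show "{(A 0 *\<^sub>v x) $ 0 | x. x \<in> carrier_vec (b 0)} = I" by (rule image)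
    show "mat_kernel (A i) = {A (Suc i) *\<^sub>v x | x. x \<in> carrier_vec (b (Suc i))}" for i
    proof -
      have "mat_kernel (A i) = {col_mat (b i) (D (Suc i)) *\<^sub>v x | x. x \<in> carrier_vec (b (Suc i))}"
        unfolding A_def b_def by (rule mat_kernel_col_mat[OF _ D(2)]) (rule supp)
      then show ?thesis by (simp add: A_def rows_def)
    qed
  qed
  \<comment> \<open>Minimality: the exponent 0 has degree 0 and cannot occur in a linear
    form.\<close>
  moreover have "Poly_Mapping.lookup (A (Suc i) $$ (k, j)) 0 = 0" if "k < b i" "j < b (Suc i)" for i k j
  proof (rule ccontr)
    assume "Poly_Mapping.lookup (A (Suc i) $$ (k, j)) 0 \<noteq> 0"
    then have "0 \<in> Poly_Mapping.keys (A (Suc i) $$ (k, j))" by (simp add: in_keys_iff)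
    then show False using AShom[OF that] by (auto simp: homogeneous_def)
  qed
  ultimately show ?thesis
    unfolding has_linear_resolution_def minimal_graded_free_resolution_def
    by (intro exI[of _ b] exI[of _ "\<lambda>i j. d + i"] exI[of _ A] exI[of _ d]) auto
qed

section \<open>Linear relations and leaf orders\<close>

text \<open>For finite sets of equal size the condition is symmetric in \<open>H\<close> and
  \<open>K\<close>: one vertex is exchanged for another.\<close>

definition linear_steps :: "'v set set \<Rightarrow> 'v set \<Rightarrow> ('v set \<times> 'v set) set" where
  "linear_steps \<F> U =
     {(H, K). H \<in> \<F> \<and> K \<in> \<F> \<and> H \<subseteq> U \<and> K \<subseteq> U \<and> card (K - H) = 1}"

text \<open>Confining the path to \<open>F \<union> G\<close> means using only generators that
  divide the least common multiple of the two monomials.\<close>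

definition linearly_related :: "'v set set \<Rightarrow> bool" where
  "linearly_related \<F> \<longleftrightarrow> (\<forall>F\<in>\<F>. \<forall>G\<in>\<F>. (F, G) \<in> (linear_steps \<F> (F \<union> G))\<^sup>*)"

text \<open>The resulting order is the combinatorial form of linear quotients. Leaves are assumed
  for all nonempty subfamilies so that the assumption passes to the family without its leaf.\<close>

lemma linearly_related_order:
  assumes "finite \<F>" "linearly_related \<F>" "\<forall>F\<in>\<F>. finite F \<and> card F = d"
    and "\<And>\<G>. \<G> \<subseteq> \<F> \<Longrightarrow> \<G> \<noteq> {} \<Longrightarrow>
      \<exists>F\<in>\<G>. \<G> = {F} \<or> (\<exists>G\<in>\<G>. G \<noteq> F \<and> (\<forall>H\<in>\<G>. H \<noteq> F \<longrightarrow> F \<inter> H \<subseteq> F \<inter> G))"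
  shows "\<exists>Fs. distinct Fs \<and> set Fs = \<F> \<and>
    (\<forall>i<length Fs. \<forall>j<i. \<exists>k<i. \<exists>x\<in>Fs ! j. Fs ! k - Fs ! i = {x})"
  using assms
proof (induction \<F> rule: finite_psubset_induct)
  case (psubset \<F>)
  show ?case
  proof (cases "\<F> = {}")
    case True
    then show ?thesis by (intro exI[of _ "[]"]) auto
  next
    case False
    from psubset.prems(3)[OF order_refl False] obtain F where F: "F \<in> \<F>"
      "\<F> = {F} \<or> (\<exists>G\<in>\<F>. G \<noteq> F \<and> (\<forall>H\<in>\<F>. H \<noteq> F \<longrightarrow> F \<inter> H \<subseteq> F \<inter> G))" by blast
    let ?\<G> = "\<F> - {F}"
    have "linearly_related ?\<G>"
      unfolding linearly_related_def
    proof (intro ballI)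
      fix H K assume HK: "H \<in> ?\<G>" "K \<in> ?\<G>"
      then obtain G where G: "G \<in> \<F>" "G \<noteq> F" "\<forall>H\<in>\<F>. H \<noteq> F \<longrightarrow> F \<inter> H \<subseteq> F \<inter> G"
        using F(2) by auto
      \<comment> \<open>Distinct members of equal cardinality cannot be nested, so the leaf has a
        vertex outside its branch \<open>G\<close>.\<close>
      have "\<not> F \<subseteq> G"
        using card_subset_eq[of G F] G(1,2) F(1) psubset.prems(2) by auto
      \<comment> \<open>A vertex of the leaf outside its branch lies in no other facet.\<close>
      then have "\<not> F \<subseteq> H \<union> K" using G(3) HK by blast
      then have "linear_steps \<F> (H \<union> K) = linear_steps ?\<G> (H \<union> K)"
        by (auto simp: linear_steps_def)
      then show "(H, K) \<in> (linear_steps ?\<G> (H \<union> K))\<^sup>*"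
        using psubset.prems(1) HK unfolding linearly_related_def by (metis DiffD1)
    qed
    have "?\<G> \<subset> \<F>" using F(1) by blast
    obtain Fs where Fs: "distinct Fs" "set Fs = ?\<G>"
      "\<forall>i<length Fs. \<forall>j<i. \<exists>k<i. \<exists>x\<in>Fs ! j. Fs ! k - Fs ! i = {x}"
    proof -
      have "\<exists>Fs. distinct Fs \<and> set Fs = ?\<G> \<and>
        (\<forall>i<length Fs. \<forall>j<i. \<exists>k<i. \<exists>x\<in>Fs ! j. Fs ! k - Fs ! i = {x})"
      proof (rule psubset.IH)
        show "\<forall>F\<in>?\<G>. finite F \<and> card F = d" using psubset.prems(2) by blast
        fix \<G>' assume "\<G>' \<subseteq> ?\<G>" "\<G>' \<noteq> {}"
        then show "\<exists>F\<in>\<G>'. \<G>' = {F} \<or>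
          (\<exists>G\<in>\<G>'. G \<noteq> F \<and> (\<forall>H\<in>\<G>'. H \<noteq> F \<longrightarrow> F \<inter> H \<subseteq> F \<inter> G))"
          by (intro psubset.prems(3)) auto
      qed fact+
      then show thesis using that by blast
    qed
    have last: "\<exists>k<length Fs. \<exists>x\<in>Fs ! j. Fs ! k - F = {x}" if "j < length Fs" for j
    proof -
      have J: "Fs ! j \<in> \<F>" "Fs ! j \<noteq> F" using Fs(2) nth_mem[OF that] by auto
      have "(F, Fs ! j) \<in> (linear_steps \<F> (F \<union> Fs ! j))\<^sup>*"
        using psubset.prems(1) F(1) J(1) by (simp add: linearly_related_def)
      \<comment> \<open>The first step of the path leaving \<open>F\<close> suffices:
        \<open>K\<close> has one vertex outside \<open>F\<close>, and it lies in
        \<open>Fs ! j\<close> because \<open>K\<close> stays inside the union.\<close>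
      then obtain K where "(F, K) \<in> linear_steps \<F> (F \<union> Fs ! j)"
        using J(2) by (metis converse_rtranclE)
      then have K: "K \<in> \<F>" "K \<subseteq> F \<union> Fs ! j" "card (K - F) = 1"
        by (auto simp: linear_steps_def)
      then obtain x where x: "K - F = {x}" by (metis card_1_singletonE)
      then have "K \<in> set Fs" using K(1) Fs(2) by auto
      then obtain k where "k < length Fs" "Fs ! k = K" by (metis in_set_conv_nth)
      then show ?thesis using x K(2) by blast
    qed
    show ?thesis
    proof (intro exI[of _ "Fs @ [F]"] conjI allI impI)
      show "distinct (Fs @ [F])" "set (Fs @ [F]) = \<F>" using Fs(1,2) F(1) by auto
      fix i j assume ij: "i < length (Fs @ [F])" "j < i"
      show "\<exists>k<i. \<exists>x\<in>(Fs @ [F]) ! j. (Fs @ [F]) ! k - (Fs @ [F]) ! i = {x}"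
      proof (cases "i < length Fs")
        case True
        then obtain k x where "k < i" "x \<in> Fs ! j" "Fs ! k - Fs ! i = {x}"
          using Fs(3) ij(2) by blast
        then show ?thesis using True ij(2) by (intro exI[of _ k]) (auto simp: nth_append)
      next
        case False
        then have i: "i = length Fs" using ij(1) by simp
        obtain k x where "k < i" "x \<in> Fs ! j" "Fs ! k - F = {x}"
          using last[of j] ij(2) i by blast
        then show ?thesis using i ij(2) by (intro exI[of _ k]) (auto simp: nth_append)
      qed
    qed
  qed
qed

section \<open>Squarefree monomials\<close>

definition ind :: "'v set \<Rightarrow> 'v \<Rightarrow>\<^sub>0 nat" where
  "ind A = (\<Sum>v\<in>A. Poly_Mapping.single v 1)"

lemma lookup_ind: "Poly_Mapping.lookup (ind A) (v :: 'v::finite) = (if v \<in> A then 1 else 0)"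
  by (simp add: ind_def lookup_sum lookup_single when_def)

lemma keys_ind [simp]: "Poly_Mapping.keys (ind (A :: 'v::finite set)) = A"
  by (auto simp: in_keys_iff lookup_ind split: if_splits)

lemma ind_eq_iff: "ind A = ind B \<longleftrightarrow> A = (B :: 'v::finite set)"
  by (metis keys_ind)

lemma ind_empty [simp]: "ind {} = 0"
  by (simp add: ind_def)

lemma exp_degree_ind [simp]: "exp_degree (ind (A :: 'v::finite set)) = card A"
  by (simp add: exp_degree_def lookup_ind)

lemma ind_union: "A \<inter> B = {} \<Longrightarrow> ind (A \<union> B) = ind A + ind (B :: 'v::finite set)"
  by (simp add: ind_def sum.union_disjoint)

lemma ind_diff: "A \<subseteq> B \<Longrightarrow> ind B = ind (B - A) + ind (A :: 'v::finite set)"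
  using ind_union[of "B - A" A] by (simp add: Un_absorb2 Diff_Int_distrib2 Int_commute)

lemma prod_var: "(\<Prod>v\<in>A. var v) = Poly_Mapping.single (ind A) 1"
proof (induction A rule: infinite_finite_induct)
  case (insert v A)
  then show ?case by (simp add: var_def ind_def mult_single)
qed (simp_all add: ind_def)

text \<open>Divisibility by a squarefree monomial is inclusion of supports: on \<open>A\<close> the
  exponents of \<open>m\<close> are at least 1, so the truncated subtraction is exact.\<close>

lemma add_ind_iff: "(\<exists>q. m = q + ind A) \<longleftrightarrow> A \<subseteq> Poly_Mapping.keys (m :: 'v::finite \<Rightarrow>\<^sub>0 nat)"
proof
  assume A: "A \<subseteq> Poly_Mapping.keys m"
  have "m = (m - ind A) + ind A"
  proof (rule poly_mapping_eqI)
    fix v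
    have "v \<in> A \<Longrightarrow> Poly_Mapping.lookup m v \<noteq> 0" using A by (auto simp: in_keys_iff)
    then show "Poly_Mapping.lookup m v = Poly_Mapping.lookup (m - ind A + ind A) v"
      by (simp add: lookup_add lookup_minus lookup_ind)
  qed
  then show "\<exists>q. m = q + ind A" by blast
qed (auto simp: keys_add_nat)

lemma lookup_times_ind:
  fixes f :: "('v::finite, 'k::field) mpoly_ring"
  shows "Poly_Mapping.lookup (f * Poly_Mapping.single (ind A) c) (ind B) =
    (if A \<subseteq> B then Poly_Mapping.lookup f (ind (B - A)) * c else 0)"
proof (cases "A \<subseteq> B")
  case True
  then have "ind B = ind (B - A) + ind A"
    by (rule ind_diff)
  then show ?thesis using True by simp
next
  case False
  then have "ind B \<noteq> q + ind A" for q
    using add_ind_iff[of "ind B" A] by auto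
  then show ?thesis using False by (simp add: lookup_times_single_not_add)
qed

lemma linear_form_eq_sum:
  fixes g :: "('v::finite, 'k::field) mpoly_ring"
  assumes "homogeneous 1 g"
  shows "g = (\<Sum>v\<in>UNIV. Poly_Mapping.single (ind {v}) (Poly_Mapping.lookup g (ind {v})))"
proof (rule poly_mapping_eqI)
  fix m
  let ?h = "\<Sum>v\<in>UNIV. Poly_Mapping.single (ind {v}) (Poly_Mapping.lookup g (ind {v}))"
  show "Poly_Mapping.lookup g m = Poly_Mapping.lookup ?h m"
  proof (cases "\<exists>v. m = ind {v}")
    case True
    then obtain v where m: "m = ind {v}" by blast
    show ?thesis by (simp add: m lookup_sum lookup_single when_def ind_eq_iff)
  next
    case False
    then have "exp_degree m \<noteq> 1"
      by (metis exp_degree_1E ind_def sum.empty sum.insert finite.emptyI empty_iff add_0_right)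
    then have "Poly_Mapping.lookup g m = 0"
      using assms by (auto simp: homogeneous_def in_keys_iff)
    then show ?thesis using False by (auto simp: lookup_sum lookup_single when_def intro!: sum.neutral)
  qed
qed

text \<open>A squarefree monomial splits off a variable only at a vertex \<open>v\<close> of
  \<open>T\<close>, leaving the squarefree monomial of \<open>T - {v}\<close>.\<close>

lemma lookup_mult_linear:
  fixes f g :: "('v::finite, 'k::field) mpoly_ring"
  assumes "homogeneous 1 g"
  shows "Poly_Mapping.lookup (f * g) (ind T) =
    (\<Sum>v\<in>T. Poly_Mapping.lookup f (ind (T - {v})) * Poly_Mapping.lookup g (ind {v}))"
proof -
  have "Poly_Mapping.lookup (f * g) (ind T) =
    (\<Sum>v\<in>UNIV. Poly_Mapping.lookup (f * Poly_Mapping.single (ind {v}) (Poly_Mapping.lookup g (ind {v}))) (ind T))"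
    by (subst linear_form_eq_sum[OF assms]) (simp only: sum_distrib_left lookup_sum)
  also have "\<dots> = (\<Sum>v\<in>UNIV. if v \<in> T
      then Poly_Mapping.lookup f (ind (T - {v})) * Poly_Mapping.lookup g (ind {v}) else 0)"
    by (simp add: lookup_times_ind)
  also have "\<dots> = (\<Sum>v\<in>T. Poly_Mapping.lookup f (ind (T - {v})) * Poly_Mapping.lookup g (ind {v}))"
    by (simp add: sum.If_cases)
  finally show ?thesis .
qed

text \<open>All terms of \<open>f\<close> already have the degree of \<open>m\<close>, so only the
  constant term of \<open>g\<close> can contribute.\<close>

lemma lookup_mult_constant:
  fixes f g :: "('v, 'k::field) mpoly_ring"
  assumes "homogeneous (exp_degree m) f"
  shows "Poly_Mapping.lookup (f * g) m = Poly_Mapping.lookup f m * Poly_Mapping.lookup g 0"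
proof -
  have "hom_comp 0 g = Poly_Mapping.single 0 (Poly_Mapping.lookup g 0)"
    by (rule poly_mapping_eqI)
      (auto simp: hom_comp.rep_eq lookup_single when_def exp_degree_eq_0_iff)
  then have "hom_comp (exp_degree m) (g * f) = f * Poly_Mapping.single 0 (Poly_Mapping.lookup g 0)"
    using hom_comp_mult[OF assms, of 0 g] by (simp add: mult.commute)
  moreover have "Poly_Mapping.lookup (f * g) m = Poly_Mapping.lookup (hom_comp (exp_degree m) (g * f)) m"
    by (simp add: hom_comp.rep_eq mult.commute)
  ultimately show ?thesis
    using lookup_times_single_add[of f 0 "Poly_Mapping.lookup g 0" m] by simp
qed

section \<open>Linear first syzygies give linear relations\<close>

text \<open>Here \<open>a\<close> is the augmentation and the columns of \<open>B\<close> are linear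
  syzygies generating all others. If \<open>F\<close> and \<open>G\<close> were not joined, the
  functional \<open>L\<close> below would take the value 1 on their monomial relation and 0 on every
  combination of the columns of \<open>B\<close>. The \<open>a j\<close> may be any homogeneous
  generators, so coefficients of monomials are counted.\<close>

lemma linear_syzygies:
  fixes a :: "nat \<Rightarrow> ('v::finite, 'k::field) mpoly_ring" and B :: "nat \<Rightarrow> nat \<Rightarrow> ('v, 'k) mpoly_ring"
  assumes antichain: "\<And>F G. F \<in> \<F> \<Longrightarrow> G \<in> \<F> \<Longrightarrow> F \<subseteq> G \<Longrightarrow> F = G"
    and hom_a: "\<And>j. j < n \<Longrightarrow> homogeneous d (a j)"
    and a_in: "\<And>j m. j < n \<Longrightarrow> m \<in> Poly_Mapping.keys (a j) \<Longrightarrow> \<exists>F\<in>\<F>. F \<subseteq> Poly_Mapping.keys m"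
    and gen: "\<And>F. F \<in> \<F> \<Longrightarrow> \<exists>w. Poly_Mapping.single (ind F) 1 = (\<Sum>j<n. a j * w j)"
    and hom_B: "\<And>j k. j < n \<Longrightarrow> k < p \<Longrightarrow> homogeneous 1 (B j k)"
    and rel: "\<And>k. k < p \<Longrightarrow> (\<Sum>j<n. a j * B j k) = 0"
    and exact: "\<And>w. (\<Sum>j<n. a j * w j) = 0 \<Longrightarrow> \<exists>y. \<forall>j<n. w j = (\<Sum>k<p. B j k * y k)"
  shows "\<forall>F\<in>\<F>. card F = d" "linearly_related \<F>"
proof -
  show card: "\<forall>F\<in>\<F>. card F = d"
  proof
    fix F assume F: "F \<in> \<F>"
    from gen[OF F] obtain w where "Poly_Mapping.single (ind F) 1 = (\<Sum>j<n. a j * w j)" ..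
    then have "ind F \<in> Poly_Mapping.keys (\<Sum>j<n. a j * w j)"
      by (metis in_keys_iff lookup_single_eq zero_neq_one)
    then obtain j where j: "j < n" "ind F \<in> Poly_Mapping.keys (a j * w j)"
      by (auto dest: keys_sumD)
    from keys_multD[OF j(2)] obtain m q
      where mq: "m \<in> Poly_Mapping.keys (a j)" "ind F = m + q" by blast
    from a_in[OF j(1) mq(1)] obtain G where G: "G \<in> \<F>" "G \<subseteq> Poly_Mapping.keys m" by blast
    have "Poly_Mapping.keys m \<subseteq> F"
      using keys_add_nat[of m q] mq(2) keys_ind[of F] by auto
    \<comment> \<open>Hence the support of \<open>m\<close> is all of \<open>F\<close>, and the two
      bounds below make its degree \<open>d\<close> equal to \<open>card F\<close>.\<close>
    then have "G = F" using antichain[OF G(1) F] G(2) by blast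
    have "exp_degree m = d" using hom_a[OF j(1)] mq(1) by (simp add: homogeneous_def)
    moreover have "(\<Sum>v\<in>F. 1) \<le> exp_degree m"
      unfolding exp_degree_superset[of F m, OF finite \<open>Poly_Mapping.keys m \<subseteq> F\<close>]
      using G(2) \<open>G = F\<close> by (intro sum_mono) (auto simp: in_keys_iff Suc_le_eq)
    moreover have "exp_degree m \<le> card F"
      using arg_cong[OF mq(2), of exp_degree] by (simp add: exp_degree_add)
    ultimately show "card F = d" by simp
  qed
  \<comment> \<open>A squarefree term of degree \<open>d\<close> contains a member of
    \<open>\<F>\<close> with \<open>d\<close> elements and so coincides with it.\<close>
  have supp_a: "H \<in> \<F>" if j: "j < n" and nz: "Poly_Mapping.lookup (a j) (ind H) \<noteq> 0" for j H
  proof -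
    have H: "ind H \<in> Poly_Mapping.keys (a j)" using nz by (simp add: in_keys_iff)
    then have "card H = d" using hom_a[OF j] by (auto simp: homogeneous_def)
    moreover obtain F where "F \<in> \<F>" "F \<subseteq> H" using a_in[OF j H] by auto
    ultimately show ?thesis using card card_subset_eq[of H F] by simp
  qed
  show "linearly_related \<F>"
    unfolding linearly_related_def
  proof (intro ballI, rule ccontr)
    fix F G assume FG: "F \<in> \<F>" "G \<in> \<F>"
    let ?u = "F \<union> G"
    define C where "C = {H. (F, H) \<in> (linear_steps \<F> ?u)\<^sup>*}"
    assume "(F, G) \<notin> (linear_steps \<F> ?u)\<^sup>*"
    then have GC: "G \<notin> C" by (simp add: C_def)
    have FC: "F \<in> C" by (simp add: C_def)
    have C_sub: "H \<in> \<F> \<and> H \<subseteq> ?u" if "H \<in> C" for H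
    proof -
      from that have "(F, H) \<in> (linear_steps \<F> ?u)\<^sup>*" by (simp add: C_def)
      then show ?thesis using FG(1) by cases (auto simp: linear_steps_def)
    qed
    \<comment> \<open>The coefficient of \<open>x\<^bsup>?u\<^esup>\<close>, counting only the generators in the component \<open>C\<close> of \<open>F\<close>.\<close>
    define L where "L w = (\<Sum>H\<in>C. \<Sum>j<n. Poly_Mapping.lookup (a j) (ind H) *
      Poly_Mapping.lookup (w j) (ind (?u - H)))" for w :: "nat \<Rightarrow> ('v, 'k) mpoly_ring"
    obtain wF where wF: "Poly_Mapping.single (ind F) 1 = (\<Sum>j<n. a j * wF j)" using gen[OF FG(1)] ..
    obtain wG where wG: "Poly_Mapping.single (ind G) 1 = (\<Sum>j<n. a j * wG j)" using gen[OF FG(2)] ..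
    \<comment> \<open>The relation that lifts the monomials of \<open>F\<close> and \<open>G\<close>
      to that of their union, written in the generators \<open>a\<close>.\<close>
    define w where "w j = wF j * Poly_Mapping.single (ind (?u - F)) 1 -
      wG j * Poly_Mapping.single (ind (?u - G)) 1" for j
    have "(\<Sum>j<n. a j * w j) = Poly_Mapping.single (ind F) 1 * Poly_Mapping.single (ind (?u - F)) 1 -
        Poly_Mapping.single (ind G) 1 * Poly_Mapping.single (ind (?u - G)) 1"
      unfolding wF wG w_def
      by (simp add: sum_distrib_right right_diff_distrib sum_subtractf mult.assoc)
    also have "\<dots> = 0"
      using ind_diff[of F ?u] ind_diff[of G ?u]
      by (simp add: mult_single add.commute)
    finally obtain y where y: "\<forall>j<n. w j = (\<Sum>k<p. B j k * y k)" using exact by blast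

    \<comment> \<open>For \<open>H = F'\<close> only the constant terms of \<open>w'\<close>
      survive, and they recover the coefficient 1 of \<open>F'\<close>. For
      \<open>H \<noteq> F'\<close> the antichain property excludes the required
      divisibility.\<close>
    have coeff: "(\<Sum>j<n. Poly_Mapping.lookup (a j) (ind H) *
        Poly_Mapping.lookup (w' j * Poly_Mapping.single (ind (?u - F')) 1) (ind (?u - H))) =
        (if H = F' then 1 else 0)"
      if H: "H \<in> C" and F': "F' \<in> \<F>" "F' \<subseteq> ?u"
        and w': "Poly_Mapping.single (ind F') 1 = (\<Sum>j<n. a j * w' j)" for H F' w'
    proof (cases "H = F'")
      case True
      have "homogeneous (exp_degree (ind F')) (a j)" if "j < n" for j
        using hom_a[OF that] card F'(1) by simp
      then have "(\<Sum>j<n. Poly_Mapping.lookup (a j) (ind F') * Poly_Mapping.lookup (w' j) 0) =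
        Poly_Mapping.lookup (\<Sum>j<n. a j * w' j) (ind F')"
        by (simp add: lookup_sum lookup_mult_constant)
      also have "\<dots> = 1" by (simp flip: w')
      finally show ?thesis using True by (simp add: lookup_times_ind)
    next
      case False
      have "\<not> ?u - F' \<subseteq> ?u - H"
        using antichain[of H F'] C_sub[OF H] F' False by blast
      then show ?thesis using False by (simp add: lookup_times_ind)
    qed
    have "L w = (\<Sum>H\<in>C. (if H = F then 1 else 0) - (if H = G then 1 else 0))"
      unfolding L_def w_def
    proof (rule sum.cong[OF refl])
      fix H assume H: "H \<in> C"
      show "(\<Sum>j<n. Poly_Mapping.lookup (a j) (ind H) *
          Poly_Mapping.lookup (wF j * Poly_Mapping.single (ind (?u - F)) 1 -
            wG j * Poly_Mapping.single (ind (?u - G)) 1) (ind (?u - H))) =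
        (if H = F then 1 else 0) - (if H = G then 1 else 0)"
        unfolding lookup_minus right_diff_distrib sum_subtractf
        using coeff[OF H FG(1) _ wF] coeff[OF H FG(2) _ wG] by simp
    qed
    also have "\<dots> = 1" using FC GC by (simp add: sum_subtractf)
    finally have L1: "L w = 1" .

    \<comment> \<open>For \<open>v\<close> outside \<open>H\<close>, the share of the exponent
      \<open>ind H\<close> in the coefficient of \<open>ind (insert v H)\<close> in the
      \<open>k\<close>-th relation.\<close>
    define \<gamma> where "\<gamma> k H v = (\<Sum>j<n. Poly_Mapping.lookup (a j) (ind H) *
      Poly_Mapping.lookup (B j k) (ind {v}))" for k H v
    \<comment> \<open>The facets inside a fixed \<open>T\<close> with \<open>d + 1\<close> elements are pairwise adjacent, so \<open>C\<close> contains
      all or none of them; in the former case the sum is the coefficient of \<open>x\<^bsup>T\<^esup>\<close> in a relation.\<close>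
    have zero: "(\<Sum>v\<in>{v \<in> T. T - {v} \<in> C}. \<gamma> k (T - {v}) v) = 0" if k: "k < p" and T: "T \<subseteq> ?u" for k T
    proof (cases "\<exists>v0\<in>T. T - {v0} \<in> C")
      case True
      then obtain v0 where v0: "v0 \<in> T" "T - {v0} \<in> C" by blast
      have "\<gamma> k (T - {v}) v = 0" if v: "v \<in> T" "T - {v} \<notin> C" for v
      proof -
        have "T - {v} \<notin> \<F>"
        proof
          assume F: "T - {v} \<in> \<F>"
          have "v \<noteq> v0" using v v0 by blast
          then have "(T - {v}) - (T - {v0}) = {v0}" using v0(1) by blast
          then have "(T - {v0}, T - {v}) \<in> linear_steps \<F> ?u"
            using F C_sub[OF v0(2)] T by (auto simp: linear_steps_def)
          then have "T - {v} \<in> C" using v0(2) by (auto simp: C_def intro: rtrancl_into_rtrancl)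
          then show False using v(2) by simp
        qed
        then have "Poly_Mapping.lookup (a j) (ind (T - {v})) = 0" if "j < n" for j
          using supp_a[OF that] by blast
        then show ?thesis by (simp add: \<gamma>_def)
      qed
      then have "(\<Sum>v\<in>{v \<in> T. T - {v} \<in> C}. \<gamma> k (T - {v}) v) = (\<Sum>v\<in>T. \<gamma> k (T - {v}) v)"
        by (intro sum.mono_neutral_left) auto
      also have "\<dots> = (\<Sum>j<n. \<Sum>v\<in>T. Poly_Mapping.lookup (a j) (ind (T - {v})) *
          Poly_Mapping.lookup (B j k) (ind {v}))"
        unfolding \<gamma>_def by (rule sum.swap)
      also have "\<dots> = Poly_Mapping.lookup (\<Sum>j<n. a j * B j k) (ind T)"
        using hom_B[OF _ k] by (simp add: lookup_sum lookup_mult_linear)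
      also have "\<dots> = 0" by (simp add: rel[OF k])
      finally show ?thesis .
    next
      case False
      then have "{v \<in> T. T - {v} \<in> C} = {}" by blast
      then show ?thesis by (simp only: sum.empty)
    qed
    have w_coeff: "Poly_Mapping.lookup (w j) (ind (?u - H)) = (\<Sum>k<p. \<Sum>v\<in>?u - H.
        Poly_Mapping.lookup (y k) (ind (?u - insert v H)) * Poly_Mapping.lookup (B j k) (ind {v}))"
      if j: "j < n" for j H
    proof -
      have "Poly_Mapping.lookup (w j) (ind (?u - H)) =
        (\<Sum>k<p. Poly_Mapping.lookup (y k * B j k) (ind (?u - H)))"
        using y j by (simp only: lookup_sum mult.commute)
      also have "\<dots> = (\<Sum>k<p. \<Sum>v\<in>?u - H.
        Poly_Mapping.lookup (y k) (ind (?u - H - {v})) * Poly_Mapping.lookup (B j k) (ind {v}))"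
        using hom_B[OF j] by (simp add: lookup_mult_linear)
      finally show ?thesis
        unfolding Diff_insert[of ?u _ H] .
    qed
    have "L w = (\<Sum>H\<in>C. \<Sum>j<n. \<Sum>k<p. \<Sum>v\<in>?u - H. Poly_Mapping.lookup (y k) (ind (?u - insert v H)) *
      (Poly_Mapping.lookup (a j) (ind H) * Poly_Mapping.lookup (B j k) (ind {v})))"
      unfolding L_def
      by (intro sum.cong refl) (simp add: w_coeff sum_distrib_left mult.left_commute)
    also have "\<dots> = (\<Sum>H\<in>C. \<Sum>k<p. \<Sum>v\<in>?u - H. Poly_Mapping.lookup (y k) (ind (?u - insert v H)) * \<gamma> k H v)"
      unfolding \<gamma>_def sum_distrib_left
      by (subst sum.swap, rule sum.cong[OF refl], subst sum.swap) (rule refl)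
    also have "\<dots> = (\<Sum>k<p. \<Sum>H\<in>C. \<Sum>v\<in>?u - H. Poly_Mapping.lookup (y k) (ind (?u - insert v H)) * \<gamma> k H v)"
      by (rule sum.swap)
    \<comment> \<open>Pairs of \<open>H\<close> and a new vertex \<open>v\<close> are regrouped by
      \<open>T = insert v H\<close>. The coefficient of \<open>y k\<close> then depends on
      \<open>T\<close> alone and factors out, so that \<open>zero\<close> applies.\<close>
    also have "\<dots> = (\<Sum>k<p. \<Sum>T\<in>Pow ?u. \<Sum>v\<in>{v \<in> T. T - {v} \<in> C}.
        Poly_Mapping.lookup (y k) (ind (?u - T)) * \<gamma> k (T - {v}) v)"
    proof (rule sum.cong[OF refl])
      fix k
      have "(\<Sum>H\<in>C. \<Sum>v\<in>?u - H. Poly_Mapping.lookup (y k) (ind (?u - insert v H)) * \<gamma> k H v) =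
        (\<Sum>(H, v)\<in>Sigma C (\<lambda>H. ?u - H). Poly_Mapping.lookup (y k) (ind (?u - insert v H)) * \<gamma> k H v)"
        by (rule sum.Sigma) auto
      also have "\<dots> = (\<Sum>(T, v)\<in>Sigma (Pow ?u) (\<lambda>T. {v \<in> T. T - {v} \<in> C}).
        Poly_Mapping.lookup (y k) (ind (?u - T)) * \<gamma> k (T - {v}) v)"
      proof (rule sum.reindex_bij_witness[where i = "\<lambda>(T, v). (T - {v}, v)" and j = "\<lambda>(H, v). (insert v H, v)"],
          goal_cases)
        case (2 x)
        then show ?case using C_sub by auto
      qed (auto simp: insert_absorb)
      also have "\<dots> = (\<Sum>T\<in>Pow ?u. \<Sum>v\<in>{v \<in> T. T - {v} \<in> C}.
        Poly_Mapping.lookup (y k) (ind (?u - T)) * \<gamma> k (T - {v}) v)"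
        by (rule sum.Sigma[symmetric]) auto
      finally show "(\<Sum>H\<in>C. \<Sum>v\<in>?u - H. Poly_Mapping.lookup (y k) (ind (?u - insert v H)) * \<gamma> k H v) = \<dots>" .
    qed
    also have "\<dots> = 0"
      using zero by (simp flip: sum_distrib_left)
    finally show False using L1 by simp
  qed
qed

section \<open>Facet ideals\<close>

text \<open>Defined for any family, since the colon ideals also involve initial segments of a facet
  order.\<close>

abbreviation edge_ideal :: "'v set set \<Rightarrow> ('v, 'k::field) mpoly_ring set" where
  "edge_ideal \<F> \<equiv> gen_ideal ((\<lambda>m. Poly_Mapping.single m 1) ` ind ` \<F>)"

lemma facet_ideal_eq: "facet_ideal \<Delta> = edge_ideal (facets \<Delta>)"
  by (simp add: facet_ideal_def prod_var image_image)

lemma in_edge_ideal_iff: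
  fixes f :: "('v::finite, 'k::field) mpoly_ring"
  shows "f \<in> edge_ideal \<F> \<longleftrightarrow>
    (\<forall>m\<in>Poly_Mapping.keys f. \<exists>F\<in>\<F>. F \<subseteq> Poly_Mapping.keys m)"
proof -
  have "(\<exists>p\<in>ind ` \<F>. \<exists>q. m = q + p) \<longleftrightarrow> (\<exists>F\<in>\<F>. F \<subseteq> Poly_Mapping.keys m)" for m
    by (simp add: add_ind_iff)
  then show ?thesis unfolding in_monomial_ideal_iff by simp
qed

text \<open>The first two maps supply the data of \<open>linear_syzygies\<close>: the row of
  \<open>A 0\<close> gives \<open>a\<close>, the matrix \<open>A 1\<close> gives \<open>B\<close>,
  and the kernel condition at stage 0 gives exactness.\<close>

lemma linear_resolution_imp_linearly_related:
  fixes \<F> :: "'v::finite set set"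
  assumes antichain: "\<And>F G. F \<in> \<F> \<Longrightarrow> G \<in> \<F> \<Longrightarrow> F \<subseteq> G \<Longrightarrow> F = G"
    and lin: "has_linear_resolution (edge_ideal \<F> :: ('v, 'k::field) mpoly_ring set)"
  shows "(\<exists>d. \<forall>F\<in>\<F>. card F = d) \<and> linearly_related \<F>"
proof -
  let ?I = "edge_ideal \<F> :: ('v, 'k) mpoly_ring set"
  obtain b e A d where "graded_free_resolution ?I b e A" and shifts: "\<forall>i. \<forall>j<b i. e i j = d + i"
    using lin unfolding has_linear_resolution_def minimal_graded_free_resolution_def by blast
  note resolution = this(1)[unfolded graded_free_resolution_def]
  note A0 = resolution[THEN conjunct1]
  note AS = resolution[THEN conjunct2, THEN conjunct1, rule_format]
  note hom0 = resolution[THEN conjunct2, THEN conjunct2, THEN conjunct1, rule_format]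
  note homS = resolution[THEN conjunct2, THEN conjunct2, THEN conjunct2, THEN conjunct1, rule_format]
  note image = resolution[THEN conjunct2, THEN conjunct2, THEN conjunct2, THEN conjunct2, THEN conjunct1]
  note kernel = resolution[THEN conjunct2, THEN conjunct2, THEN conjunct2, THEN conjunct2, THEN conjunct2,
      rule_format]
  define n where "n = b 0"
  define p where "p = b 1"
  have A1: "A 1 \<in> carrier_mat n p" using AS[of 0] by (simp add: n_def p_def)
  define a where "a j = A 0 $$ (0, j)" for j
  define B where "B j k = A 1 $$ (j, k)" for j k
  have mult0: "(A 0 *\<^sub>v x) $ 0 = (\<Sum>j<n. a j * x $ j)" if "x \<in> carrier_vec n" for x
    using that A0 by (auto simp: a_def n_def scalar_prod_def atLeast0LessThan intro!: sum.cong)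
  have mult1: "(A 1 *\<^sub>v x) $ j = (\<Sum>k<p. B j k * x $ k)" if "x \<in> carrier_vec p" "j < n" for x j
    using that A1 by (auto simp: B_def scalar_prod_def atLeast0LessThan intro!: sum.cong)
  have kernel0: "mat_kernel (A 0) = {A 1 *\<^sub>v x | x. x \<in> carrier_vec p}"
    using kernel[of 0] by (simp add: p_def)
  have in_kernel: "x \<in> mat_kernel (A 0) \<longleftrightarrow> (\<Sum>j<n. a j * x $ j) = 0" if "x \<in> carrier_vec n" for x
  proof -
    have "A 0 *\<^sub>v x = 0\<^sub>v 1 \<longleftrightarrow> (A 0 *\<^sub>v x) $ 0 = 0"
    proof
      assume *: "(A 0 *\<^sub>v x) $ 0 = 0"
      show "A 0 *\<^sub>v x = 0\<^sub>v 1"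
        using A0 * by (intro eq_vecI) (auto simp del: index_mult_mat_vec simp: less_Suc0)
    qed simp
    then show ?thesis
      using that A0 mult0[OF that] by (simp add: mat_kernel_def n_def)
  qed
  have hom_a: "homogeneous d (a j)" if "j < n" for j
    using hom0[of j] shifts that by (simp add: a_def n_def)
  have a_in: "\<exists>F\<in>\<F>. F \<subseteq> Poly_Mapping.keys m" if "j < n" "m \<in> Poly_Mapping.keys (a j)" for j m
  proof -
    have "(A 0 *\<^sub>v unit_vec n j) $ 0 = a j"
      using that(1) by (simp add: mult0 unit_vec_def if_distrib cong: if_cong)
    then have "a j \<in> ?I"
      unfolding image[symmetric] n_def[symmetric] by (auto intro!: exI[of _ "unit_vec n j"])
    then show ?thesis using that(2) by (simp add: in_edge_ideal_iff)
  qed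
  have gen: "\<exists>w. Poly_Mapping.single (ind F) 1 = (\<Sum>j<n. a j * w j)" if "F \<in> \<F>" for F
  proof -
    have "Poly_Mapping.single (ind F) 1 \<in> ?I"
      using that by (intro ideal.span_base imageI)
    then obtain x where "x \<in> carrier_vec n" "Poly_Mapping.single (ind F) 1 = (A 0 *\<^sub>v x) $ 0"
      unfolding image[symmetric] n_def by blast
    then show ?thesis using mult0 by auto
  qed
  have hom_B: "homogeneous 1 (B j k)" if "j < n" "k < p" for j k
    unfolding homogeneous_def
  proof
    fix m assume "m \<in> Poly_Mapping.keys (B j k)"
    \<comment> \<open>The shifts are \<open>d\<close> at stage 0 and \<open>d + 1\<close> at stage
      1, so the entry has degree 1.\<close>
    then have "e 0 j + exp_degree m = e 1 k"
      using homS[of j 0 k m] that by (simp add: B_def n_def p_def)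
    then show "exp_degree m = 1" using shifts that by (simp add: n_def p_def)
  qed
  have rel: "(\<Sum>j<n. a j * B j k) = 0" if "k < p" for k
  proof -
    have "A 1 *\<^sub>v unit_vec p k \<in> mat_kernel (A 0)"
      unfolding kernel0 by (auto intro!: exI[of _ "unit_vec p k"])
    then have "(\<Sum>j<n. a j * (A 1 *\<^sub>v unit_vec p k) $ j) = 0"
      using in_kernel[of "A 1 *\<^sub>v unit_vec p k"] A1 by simp
    moreover have "(A 1 *\<^sub>v unit_vec p k) $ j = B j k" if "j < n" for j
      using mult1[of "unit_vec p k" j] that \<open>k < p\<close>
      by (simp add: unit_vec_def if_distrib del: One_nat_def cong: if_cong)
    ultimately show ?thesis by simp
  qed
  have exact: "\<exists>y. \<forall>j<n. w j = (\<Sum>k<p. B j k * y k)" if w: "(\<Sum>j<n. a j * w j) = 0" for w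
  proof -
    have "vec n w \<in> mat_kernel (A 0)" using w by (simp add: in_kernel)
    then obtain x where x: "x \<in> carrier_vec p" "vec n w = A 1 *\<^sub>v x"
      unfolding kernel0 by blast
    have "w j = (\<Sum>k<p. B j k * x $ k)" if "j < n" for j
      using mult1[OF x(1) that] arg_cong[OF x(2), of "\<lambda>v. v $ j"] that by (simp del: One_nat_def)
    then show ?thesis by blast
  qed
  have "\<forall>F\<in>\<F>. card F = d" "linearly_related \<F>"
    by (rule linear_syzygies[of \<F> n d a p B]; (rule antichain hom_a a_in gen hom_B rel exact; assumption))+
  then show ?thesis by blast
qed

text \<open>A monomial lies in the \<open>i\<close>-th colon ideal iff its support together with
  \<open>Fs ! i\<close> contains an earlier \<open>Fs ! j\<close>. The order condition then finds a
  vertex of that support which by itself generates an element of the colon ideal.\<close>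

lemma order_imp_linear_quotient_ideal:
  fixes Fs :: "'v::finite set list"
  assumes antichain: "\<And>F G. F \<in> set Fs \<Longrightarrow> G \<in> set Fs \<Longrightarrow> F \<subseteq> G \<Longrightarrow> F = G"
    and card: "\<forall>F\<in>set Fs. card F = d"
    and "distinct Fs"
    and order: "\<forall>i<length Fs. \<forall>j<i. \<exists>k<i. \<exists>x\<in>Fs ! j. Fs ! k - Fs ! i = {x}"
  shows "linear_quotient_ideal (edge_ideal (set Fs) :: ('v, 'k::field) mpoly_ring set)"
proof -
  define mono :: "'v set \<Rightarrow> ('v, 'k) mpoly_ring" where "mono F = Poly_Mapping.single (ind F) 1" for F
  have mono_image: "mono ` \<G> = (\<lambda>m. Poly_Mapping.single m 1) ` ind ` \<G>" for \<G>
    by (auto simp: mono_def)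
  have keys_mono: "Poly_Mapping.keys (mono F) = {ind F}" for F by (simp add: mono_def)
  have inj: "inj mono" by (rule injI) (metis keys_mono singleton_inject ind_eq_iff)
  let ?fs = "map mono Fs"
  have minimal: "minimal_monomial_generators (edge_ideal (set Fs)) (set ?fs)"
    unfolding minimal_monomial_generators_def
  proof (intro conjI ballI allI impI)
    show "is_monomial f" if "f \<in> set ?fs" for f using that by (auto simp: is_monomial_def mono_def)
    show "gen_ideal (set ?fs) = edge_ideal (set Fs)" by (simp add: mono_image)
    fix T assume T: "T \<subset> set ?fs"
    then obtain F where F: "F \<in> set Fs" "mono F \<notin> T" by auto
    have T_eq: "T = mono ` {G \<in> set Fs. mono G \<in> T}" using T by auto
    \<comment> \<open>No generator divides another, so omitting one really shrinks the
      ideal.\<close>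
    have "mono F \<notin> gen_ideal T"
    proof
      assume "mono F \<in> gen_ideal T"
      then have "mono F \<in> edge_ideal {G \<in> set Fs. mono G \<in> T}"
        using T_eq by (simp flip: mono_image)
      then obtain G where "G \<in> set Fs" "mono G \<in> T" "G \<subseteq> F"
        unfolding in_edge_ideal_iff keys_mono by auto
      then show False using antichain F by blast
    qed
    moreover have "mono F \<in> edge_ideal (set Fs)"
      unfolding mono_image[symmetric] using F(1) by (intro ideal.span_base imageI)
    ultimately show "gen_ideal T \<noteq> edge_ideal (set Fs)" by blast
  qed
  have colon: "colon (gen_ideal (set (take i ?fs))) (?fs ! i) = gen_ideal (var ` {x. \<exists>k<i. Fs ! k - Fs ! i = {x}})"
    (is "_ = gen_ideal (var ` ?V)") if i: "i < length Fs" for i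
  proof -
    have take: "set (take i Fs) = (\<lambda>j. Fs ! j) ` {..<i}"
      using nth_image[of i Fs] i by (simp add: atLeast0LessThan)
    have key: "(\<exists>F\<in>set (take i Fs). F \<subseteq> Poly_Mapping.keys (m + ind (Fs ! i))) \<longleftrightarrow>
        Poly_Mapping.keys m \<inter> ?V \<noteq> {}" for m :: "'v \<Rightarrow>\<^sub>0 nat"
    proof
      assume "\<exists>F\<in>set (take i Fs). F \<subseteq> Poly_Mapping.keys (m + ind (Fs ! i))"
      then obtain j where j: "j < i" "Fs ! j \<subseteq> Poly_Mapping.keys m \<union> Fs ! i"
        by (auto simp: take keys_add_nat)
      obtain k x where "k < i" "x \<in> Fs ! j" "Fs ! k - Fs ! i = {x}"
        using order i j(1) by blast
      \<comment> \<open>\<open>x\<close> lies in \<open>Fs ! j\<close> but outside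
        \<open>Fs ! i\<close>, hence in the support of \<open>m\<close>.\<close>
      then have "x \<in> Poly_Mapping.keys m \<inter> ?V" using j(2) by auto
      then show "Poly_Mapping.keys m \<inter> ?V \<noteq> {}" by blast
    next
      assume "Poly_Mapping.keys m \<inter> ?V \<noteq> {}"
      then obtain x k where "x \<in> Poly_Mapping.keys m" "k < i" "Fs ! k - Fs ! i = {x}" by auto
      then have "Fs ! k \<in> set (take i Fs)" "Fs ! k \<subseteq> Poly_Mapping.keys (m + ind (Fs ! i))"
        by (auto simp: take keys_add_nat)
      then show "\<exists>F\<in>set (take i Fs). F \<subseteq> Poly_Mapping.keys (m + ind (Fs ! i))" by blast
    qed
    have "gen_ideal (set (take i ?fs)) = edge_ideal (set (take i Fs))"
      by (simp add: take_map mono_image)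
    moreover have "?fs ! i = Poly_Mapping.single (ind (Fs ! i)) 1"
      using i by (simp add: mono_def)
    ultimately have eq: "colon (gen_ideal (set (take i ?fs))) (?fs ! i) =
        {r. r * Poly_Mapping.single (ind (Fs ! i)) 1 \<in> edge_ideal (set (take i Fs))}"
      by (simp only: colon_def)
    have "r * Poly_Mapping.single (ind (Fs ! i)) 1 \<in> edge_ideal (set (take i Fs)) \<longleftrightarrow>
        r \<in> gen_ideal (var ` ?V)" for r :: "('v, 'k) mpoly_ring"
      unfolding in_edge_ideal_iff keys_times_monomial in_var_ideal_iff key[symmetric] by (rule ball_simps)
    then show ?thesis unfolding eq by blast
  qed
  show ?thesis
    unfolding linear_quotient_ideal_def
  proof (intro exI[of _ ?fs] conjI allI impI)
    show "distinct ?fs" using \<open>distinct Fs\<close> inj by (auto simp: distinct_map intro: inj_on_subset)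
    show "\<exists>d. \<forall>f\<in>set ?fs. homogeneous d f"
      using card by (intro exI[of _ d]) (auto simp: homogeneous_def keys_mono)
    fix i assume "i < length ?fs"
    then have "colon (gen_ideal (set (take i ?fs))) (?fs ! i) = gen_ideal (var ` {x. \<exists>k<i. Fs ! k - Fs ! i = {x}})"
      by (intro colon) simp
    moreover have "\<forall>g\<in>var ` {x. \<exists>k<i. Fs ! k - Fs ! i = {x}}. is_monomial (g :: ('v, 'k) mpoly_ring) \<and> homogeneous 1 g"
      using homogeneous_var by (auto simp: is_monomial_def var_def)
    ultimately show "\<exists>S. (\<forall>g\<in>S. is_monomial g \<and> homogeneous 1 g) \<and>
        colon (gen_ideal (set (take i ?fs))) (?fs ! i) = gen_ideal S" by blast
  qed (rule minimal)
qed

section \<open>Trees\<close>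

lemma facets_antichain: "F \<in> facets \<Delta> \<Longrightarrow> G \<in> facets \<Delta> \<Longrightarrow> F \<subseteq> G \<Longrightarrow> F = G"
  by (auto simp: facets_def)

text \<open>The faces contained in members of \<open>\<G>\<close> form a subcomplex whose facets are
  exactly \<open>\<G>\<close>, because facets are never nested. The tree property then provides a
  leaf.\<close>

lemma tree_facets_have_leaf:
  fixes \<Delta> :: "'v::finite set set"
  assumes "tree_complex UNIV \<Delta>" "\<G> \<subseteq> facets \<Delta>" "\<G> \<noteq> {}"
  shows "\<exists>F\<in>\<G>. \<G> = {F} \<or> (\<exists>G\<in>\<G>. G \<noteq> F \<and> (\<forall>H\<in>\<G>. H \<noteq> F \<longrightarrow> F \<inter> H \<subseteq> F \<inter> G))"
proof -
  define \<Gamma> where "\<Gamma> = {A. \<exists>F\<in>\<G>. A \<subseteq> F}"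
  have "facets \<Gamma> = \<G>"
  proof
    show "facets \<Gamma> \<subseteq> \<G>"
    proof
      fix A assume A: "A \<in> facets \<Gamma>"
      then obtain F where F: "F \<in> \<G>" "A \<subseteq> F" by (auto simp: facets_def \<Gamma>_def)
      then have "F \<in> \<Gamma>" by (auto simp: \<Gamma>_def)
      then have "F = A" using A F(2) by (simp add: facets_def)
      then show "A \<in> \<G>" using F(1) by simp
    qed
    show "\<G> \<subseteq> facets \<Gamma>"
    proof
      fix F assume F: "F \<in> \<G>"
      have "A = F" if A: "A \<in> \<Gamma>" "F \<subseteq> A" for A
      proof -
        obtain G where "G \<in> \<G>" "A \<subseteq> G" using A(1) by (auto simp: \<Gamma>_def)
        moreover have "F \<in> facets \<Delta>" "G \<in> facets \<Delta>" using F \<open>G \<in> \<G>\<close> assms(2) by blast+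
        ultimately have "F = G" using facets_antichain[of F \<Delta> G] A(2) by simp
        then show ?thesis using A(2) \<open>A \<subseteq> G\<close> by simp
      qed
      moreover have "F \<in> \<Gamma>" using F by (auto simp: \<Gamma>_def)
      ultimately show "F \<in> facets \<Gamma>" by (simp add: facets_def)
    qed
  qed
  moreover have "simplicial_complex (\<Union>\<G>) \<Gamma>"
    unfolding simplicial_complex_def
  proof (intro conjI)
    show "\<forall>F\<in>\<Gamma>. \<forall>G. G \<subseteq> F \<longrightarrow> G \<in> \<Gamma>" unfolding \<Gamma>_def by (blast intro: order_trans)
  qed (auto simp: \<Gamma>_def)
  ultimately have "subcomplex \<Gamma> \<Delta>" unfolding subcomplex_def using assms(2) by metis
  moreover have "\<Gamma> \<noteq> {}" using assms(3) by (auto simp: \<Gamma>_def)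
  ultimately obtain F where "is_leaf \<Gamma> F" using assms(1) unfolding tree_complex_def by metis
  then show ?thesis unfolding is_leaf_def \<open>facets \<Gamma> = \<G>\<close> by metis
qed

text \<open>Consecutive singletons that meet are equal, so the chain is constant. This settles the
  case of dimension 0, where a linear step would have empty intersection.\<close>

lemma singleton_facets_connected:
  assumes "facet_chain \<Delta> F G Fs" "\<forall>H\<in>facets \<Delta>. card H = 1"
  shows "F = G"
proof -
  have Fs: "Fs \<noteq> []" "set Fs \<subseteq> facets \<Delta>" "hd Fs = F" "last Fs = G"
    and meet: "\<And>i. Suc i < length Fs \<Longrightarrow> Fs ! i \<inter> Fs ! Suc i \<noteq> {}"
    using assms(1) by (auto simp: facet_chain_def)
  have "i < length Fs \<Longrightarrow> Fs ! i = Fs ! 0" for i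
  proof (induction i)
    case (Suc i)
    have "Fs ! i \<in> facets \<Delta>" "Fs ! Suc i \<in> facets \<Delta>"
      using Fs(2) nth_mem[of i Fs] nth_mem[of "Suc i" Fs] Suc.prems by auto
    then obtain x y where "Fs ! i = {x}" "Fs ! Suc i = {y}"
      using assms(2) by (metis card_1_singletonE)
    then show ?case using meet[OF Suc.prems] Suc by auto
  qed simp
  from this[of "length Fs - 1"] show ?thesis using Fs by (simp add: last_conv_nth hd_conv_nth)
qed

text \<open>A linear step from \<open>H\<close> to \<open>K\<close> omits exactly one vertex of
  \<open>K\<close> from the intersection, which is the dimension condition of a proper
  chain.\<close>

lemma linearly_related_imp_pure_connected:
  fixes \<Delta> :: "'v::finite set set"
  assumes conn: "connected_complex \<Delta>" and card: "\<forall>F\<in>facets \<Delta>. card F = d"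
    and rel: "linearly_related (facets \<Delta>)"
  shows "pure_complex \<Delta> \<and> connected_in_codim_1 \<Delta>"
proof
  show "pure_complex \<Delta>" using card by (simp add: pure_complex_def face_dim_def)
  have adjacent: "H \<inter> K \<noteq> {} \<and> face_dim (H \<inter> K) = face_dim K - 1"
    if "(H, K) \<in> linear_steps (facets \<Delta>) U" for H K U
  proof -
    have HK: "H \<in> facets \<Delta>" "K \<in> facets \<Delta>" "card (K - H) = 1"
      using that by (auto simp: linear_steps_def)
    have K: "card K = card (H \<inter> K) + 1"
      using card_Int_Diff[of K H] HK(3) by (simp add: Int_commute)
    \<comment> \<open>If \<open>d = 1\<close>, linear steps would have empty intersections, but then \<open>\<Delta>\<close> has one facet.\<close>
    have "H \<inter> K \<noteq> {}"
    proof
      assume "H \<inter> K = {}"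
      then have "d = 1" using K card HK(2) by simp
      moreover obtain Fs where "facet_chain \<Delta> H K Fs"
        using conn HK by (auto simp: connected_complex_def)
      ultimately have "H = K" using card by (intro singleton_facets_connected) auto
      then show False using HK(3) by simp
    qed
    then show ?thesis using K by (simp add: face_dim_def)
  qed
  show "connected_in_codim_1 \<Delta>"
    unfolding connected_in_codim_1_def
  proof (intro ballI impI)
    fix F G assume FG: "F \<in> facets \<Delta>" "G \<in> facets \<Delta>"
    then have "(F, G) \<in> (linear_steps (facets \<Delta>) (F \<union> G))\<^sup>*"
      using rel by (simp add: linearly_related_def)
    then show "\<exists>Fs. proper_facet_chain \<Delta> F G Fs"
    proof (induction rule: rtrancl_induct)
      case base
      have "proper_facet_chain \<Delta> F F [F]"
        using FG(1) by (simp add: proper_facet_chain_def facet_chain_def)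
      then show ?case ..
    next
      case (step H K)
      then obtain Fs where Fs: "proper_facet_chain \<Delta> F H Fs" by blast
      then have ne: "Fs \<noteq> []" "last Fs = H" by (auto simp: proper_facet_chain_def facet_chain_def)
      have "K \<in> facets \<Delta>" using step.hyps(2) by (auto simp: linear_steps_def)
      \<comment> \<open>Appending \<open>K\<close> creates a single new junction, at index
        \<open>length Fs - 1\<close>.\<close>
      have eq: "(Fs @ [K]) ! i = H \<and> (Fs @ [K]) ! Suc i = K"
        if "Suc i < length (Fs @ [K])" "\<not> Suc i < length Fs" for i
      proof -
        have "i = length Fs - 1" using that by simp
        then show ?thesis using ne by (simp add: nth_append last_conv_nth)
      qed
      have "(Fs @ [K]) ! i \<inter> (Fs @ [K]) ! Suc i \<noteq> {} \<and>
          face_dim ((Fs @ [K]) ! i \<inter> (Fs @ [K]) ! Suc i) = face_dim ((Fs @ [K]) ! Suc i) - 1"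
        if i: "Suc i < length (Fs @ [K])" for i
      proof (cases "Suc i < length Fs")
        case True
        then show ?thesis using Fs by (simp add: nth_append proper_facet_chain_def facet_chain_def)
      next
        case False
        show ?thesis using eq[OF i False] adjacent[OF step.hyps(2)] by simp
      qed
      then have "proper_facet_chain \<Delta> F K (Fs @ [K])"
        using Fs \<open>K \<in> facets \<Delta>\<close> by (auto simp: proper_facet_chain_def facet_chain_def)
      then show ?case ..
    qed
  qed
qed

theorem proposition3p9:
  fixes \<Delta> :: "'v::finite set set"
  assumes "tree_complex UNIV \<Delta>"
  shows "(linear_quotient_tree TYPE('k::field) \<Delta> \<longleftrightarrow> linear_tree TYPE('k) \<Delta>) \<and>
         (linear_quotient_tree TYPE('k) \<Delta> \<or> linear_tree TYPE('k) \<Delta>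
            \<longrightarrow> pure_complex \<Delta> \<and> connected_in_codim_1 \<Delta>)"
proof -
  have 1: "linear_tree TYPE('k) \<Delta>" if "linear_quotient_tree TYPE('k) \<Delta>"
    using that linear_quotient_ideal_imp_linear_resolution
    by (auto simp: linear_quotient_tree_def linear_tree_def)
  have related: "(\<exists>d. \<forall>F\<in>facets \<Delta>. card F = d) \<and> linearly_related (facets \<Delta>)"
    if "linear_tree TYPE('k) \<Delta>"
  proof (rule linear_resolution_imp_linearly_related)
    show "has_linear_resolution (edge_ideal (facets \<Delta>) :: ('v, 'k) mpoly_ring set)"
      using that by (simp add: linear_tree_def facet_ideal_eq)
  qed (rule facets_antichain)
  have 2: "linear_quotient_tree TYPE('k) \<Delta>" if lin: "linear_tree TYPE('k) \<Delta>"
  proof -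
    obtain d where d: "\<forall>F\<in>facets \<Delta>. card F = d" using related[OF lin] by blast
    have "\<exists>Fs. distinct Fs \<and> set Fs = facets \<Delta> \<and>
        (\<forall>i<length Fs. \<forall>j<i. \<exists>k<i. \<exists>x\<in>Fs ! j. Fs ! k - Fs ! i = {x})"
      using related[OF lin] d tree_facets_have_leaf[OF assms]
      by (intro linearly_related_order[where d = d]) auto
    then obtain Fs where Fs: "distinct Fs" "set Fs = facets \<Delta>"
        "\<forall>i<length Fs. \<forall>j<i. \<exists>k<i. \<exists>x\<in>Fs ! j. Fs ! k - Fs ! i = {x}" by blast
    have "linear_quotient_ideal (edge_ideal (set Fs) :: ('v, 'k) mpoly_ring set)"
      using d Fs(2) by (intro order_imp_linear_quotient_ideal[OF _ _ Fs(1,3)]) (auto dest: facets_antichain)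
    then show ?thesis using assms Fs(2) by (simp add: linear_quotient_tree_def facet_ideal_eq)
  qed
  have 3: "pure_complex \<Delta> \<and> connected_in_codim_1 \<Delta>" if "linear_tree TYPE('k) \<Delta>"
    using related[OF that] assms linearly_related_imp_pure_connected
    by (auto simp: tree_complex_def)
  \<comment> \<open>In the second claim, the linear quotient alternative is reduced to the linear
    one by \<open>1\<close>.\<close>
  show ?thesis using 1 2 3 by blast
qed

end
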